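(* Let $\Gamma$ be a finite group and let $\mathrm{Cay}(\Gamma,S)$ be a normal mixed Cayley graph. Then $\mathrm{Cay}(\Gamma,S)$ is HS-integral if and only if $S\setminus\overline S\in\mathbb B(\Gamma)$ and $\overline S\in\mathbb E(\Gamma)$.
   Context: Let $\Gamma$ be a finite group with identity $\mathbf 1$ and $S\subseteq\Gamma$ with $\mathbf 1\notin S$. The mixed Cayley graph $G=\mathrm{Cay}(\Gamma,S)$ has vertex set $\Gamma$ and edge set $E=\{(a,b): a,b\in\Gamma,\ ba^{-1}\in S\}$ (ordered pairs). It is normal if $S$ is a union of conjugacy classes of $\Gamma$. Put $\overline S=\{u\in S: u^{-1}\notin S\}$. A subset $A\subseteq \Gamma$ is skew-symmetric if $a^{-1}\notin A$ for all $a\in A$. The Hermitian-adjacency matrix of the second kind $\mathcal H(G)=(h_{uv})$ has $h_{uv}=1$ if $(u,v),(v,u)\in E$; $h_{uv}=\frac{1+i\sqrt3}{2}$ if $(u,v)\in E$, $(v,u)\notin E$; $h_{uv}=\frac{1-i\sqrt3}{2}$ if $(u,v)\notin E$, $(v,u)\in E$; and $h_{uv}=0$ otherwise. $G$ is HS-integral if all eigenvalues of $\mathcal H(G)$ are integers. $\mathbb B(\Gamma)$ is the Boolean algebra of subsets of $\Gamma$ generated by the subgroups of $\Gamma$, i.e. all sets obtained from subgroups by finite intersections, unions and complements. $\Gamma(3)=\{x\in\Gamma: 3\mid \mathrm{ord}(x)\}$. On $\Gamma(3)$ define $x\simeq y$ iff $y=x^k$ for some integer $k$ with $\gcd(k,\mathrm{ord}(x))=1$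 and $k\equiv1\pmod 3$; the equivalence class of $x$ is denoted $\langle\!\langle x\rangle\!\rangle$. $\mathbb E(\Gamma)$ is the set of all skew-symmetric subsets of $\Gamma$ of the form $\langle\!\langle x_1\rangle\!\rangle\cup\cdots\cup\langle\!\langle x_k\rangle\!\rangle$ with $x_1,\dots,x_k\in\Gamma(3)$, the empty union $\emptyset$ being included (so $\mathbb E(\Gamma)=\{\emptyset\}$ if $\Gamma(3)=\emptyset$). *)

theory Defs
  imports
    "HOL-Algebra.Multiplicative_Group"
    "HOL-Number_Theory.Cong"
    "Graph_Theory.Pair_Digraph"
    "Jordan_Normal_Form.Char_Poly"
begin

text \<open>Mixed graphs are the pair digraphs of \<^typ>\<open>'a pair_pre_digraph\<close>; an undirected
  edge is a pair of opposite arcs.\<close>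

definition mixed_cayley_graph :: "('a, 'b) monoid_scheme \<Rightarrow> 'a set \<Rightarrow> 'a pair_pre_digraph" where
  "mixed_cayley_graph G S =
    \<lparr>pverts = carrier G,
     parcs = {(a, b). a \<in> carrier G \<and> b \<in> carrier G \<and> b \<otimes>\<^bsub>G\<^esub> inv\<^bsub>G\<^esub> a \<in> S}\<rparr>"

definition conjugacy_class :: "('a, 'b) monoid_scheme \<Rightarrow> 'a \<Rightarrow> 'a set" where
  "conjugacy_class G x = {g \<otimes>\<^bsub>G\<^esub> x \<otimes>\<^bsub>G\<^esub> inv\<^bsub>G\<^esub> g | g. g \<in> carrier G}"

definition union_of_conjugacy_classes :: "('a, 'b) monoid_scheme \<Rightarrow> 'a set \<Rightarrow> bool" where
  "union_of_conjugacy_classes G S \<longleftrightarrow>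
    (\<exists>X \<subseteq> carrier G. S = (\<Union>x\<in>X. conjugacy_class G x))"

definition directed_part :: "('a, 'b) monoid_scheme \<Rightarrow> 'a set \<Rightarrow> 'a set" where
  "directed_part G S = {u \<in> S. inv\<^bsub>G\<^esub> u \<notin> S}"

definition skew_symmetric :: "('a, 'b) monoid_scheme \<Rightarrow> 'a set \<Rightarrow> bool" where
  "skew_symmetric G A \<longleftrightarrow> A \<subseteq> carrier G \<and> (\<forall>a\<in>A. inv\<^bsub>G\<^esub> a \<notin> A)"

definition hermitian2_entry :: "'a pair_pre_digraph \<Rightarrow> 'a \<Rightarrow> 'a \<Rightarrow> complex" where
  "hermitian2_entry D u v =
    (if (u, v) \<in> parcs D \<and> (v, u) \<in> parcs D then 1
     else if (u, v) \<in> parcs D then (1 + \<i> * complex_of_real (sqrt 3)) / 2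
     else if (v, u) \<in> parcs D then (1 - \<i> * complex_of_real (sqrt 3)) / 2
     else 0)"

text \<open>Matrices of type \<^typ>\<open>complex mat\<close> are indexed by natural numbers, so the rows and columns
  are labelled by a list \<open>vs\<close> enumerating the vertices.\<close>

definition hermitian2_matrix :: "'a pair_pre_digraph \<Rightarrow> 'a list \<Rightarrow> complex mat" where
  "hermitian2_matrix D vs =
    mat (length vs) (length vs) (\<lambda>(i, j). hermitian2_entry D (vs ! i) (vs ! j))"

text \<open>Two enumerations of the vertices give permutation-similar matrices, so the spectrum does not
  depend on the enumeration. For a finite vertex set an enumeration exists; for an infinite one
  the definition would be vacuous.\<close>

definition HS_integral :: "'a pair_pre_digraph \<Rightarrow> bool" where
  "HS_integral D \<longleftrightarrow>
    (\<forall>vs. distinct vs \<and> set vs = pverts D \<longrightarrow>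
      (\<forall>l. eigenvalue (hermitian2_matrix D vs) l \<longrightarrow> l \<in> \<int>))"

text \<open>Nullary unions and intersections need no rule: \<open>carrier G\<close> is itself a subgroup, and
  the empty set is its complement.\<close>

inductive_set boolean_algebra_subgroups :: "('a, 'b) monoid_scheme \<Rightarrow> 'a set set"
  for G :: "('a, 'b) monoid_scheme" (structure) where
  subgroup: "subgroup H G \<Longrightarrow> H \<in> boolean_algebra_subgroups G"
| inter: "\<lbrakk>A \<in> boolean_algebra_subgroups G; B \<in> boolean_algebra_subgroups G\<rbrakk>
    \<Longrightarrow> A \<inter> B \<in> boolean_algebra_subgroups G"
| union: "\<lbrakk>A \<in> boolean_algebra_subgroups G; B \<in> boolean_algebra_subgroups G\<rbrakk>
    \<Longrightarrow> A \<union> B \<in> boolean_algebra_subgroups G"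
| complement: "A \<in> boolean_algebra_subgroups G
    \<Longrightarrow> carrier G - A \<in> boolean_algebra_subgroups G"

text \<open>Meant for finite groups: \<open>group.ord\<close> is \<open>0\<close>, hence divisible by \<open>3\<close>, on elements of
  infinite order.\<close>

definition elements_of_order_div3 :: "('a, 'b) monoid_scheme \<Rightarrow> 'a set" where
  "elements_of_order_div3 G = {x \<in> carrier G. 3 dvd group.ord G x}"

definition equiv3 :: "('a, 'b) monoid_scheme \<Rightarrow> 'a \<Rightarrow> 'a \<Rightarrow> bool" where
  "equiv3 G x y \<longleftrightarrow>
    (\<exists>k::int. y = x [^]\<^bsub>G\<^esub> k \<and> coprime k (int (group.ord G x)) \<and> [k = 1] (mod 3))"

definition class3 :: "('a, 'b) monoid_scheme \<Rightarrow> 'a \<Rightarrow> 'a set" where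
  "class3 G x = {y \<in> elements_of_order_div3 G. equiv3 G x y}"

definition skew_symmetric_unions3 :: "('a, 'b) monoid_scheme \<Rightarrow> 'a set set" where
  "skew_symmetric_unions3 G =
    {A. skew_symmetric G A \<and>
        (\<exists>X. finite X \<and> X \<subseteq> elements_of_order_div3 G \<and> A = (\<Union>x\<in>X. class3 G x))}"

end

theory Submission
  imports Defs "HOL-Number_Theory.Residues" "Jordan_Normal_Form.Schur_Decomposition"
begin

text \<open>
  The Hermitian adjacency matrix is the matrix \<open>M f\<close> of convolution with a class function \<open>f\<close> that
  takes the values \<open>0\<close>, \<open>1\<close>, \<open>\<omega>\<close> and \<open>cnj \<omega>\<close>, where \<open>\<omega>\<close> is a primitive sixth root of unity. So
  \<open>M f\<close> commutes with \<open>M e\<close> for every \<open>e\<close>. If \<open>e\<close> is a linear character of a subgroup \<open>H\<close>, extended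
  by zero, then \<open>M e\<close> is \<open>card H\<close> times an idempotent. This replaces the character theory of the group.

  Suppose the spectrum of \<open>M f\<close> is integral. The nonzero eigenvalues of \<open>M f * M e\<close> are integers, and
  so is its trace. For cyclic \<open>H\<close> this says that the Fourier coefficients of \<open>f\<close> on \<open>H\<close> are rational,
  hence rational integers. Comparing them with their \<open>p\<close>-th powers modulo \<open>p\<close> yields
  \<open>f (x ^ p) = f x ^ p\<close> for every prime \<open>p\<close> not dividing \<open>6 * ord x\<close>. This is the Galois invariance
  of \<open>f\<close>, obtained without irreducibility of cyclotomic polynomials, and it gives both conditions on
  the connection set.

  Conversely, under the two conditions \<open>f\<close> is an integer combination of characters of cyclic
  subgroups. Restricted to the generalised eigenspace of an eigenvalue \<open>l\<close> of \<open>M f\<close>, of dimension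
  \<open>m\<close>, each of the corresponding matrices has integer trace. Hence \<open>m * l\<close> is an integer, and the
  algebraic integer \<open>l\<close> is rational.
\<close>

subsection \<open>Algebraic integers\<close>

text \<open>The additive group generated by \<open>V\<close>, with coefficients indexed by the
  elements of \<open>V\<close> themselves. Over an infinite \<open>V\<close> the sum is 0 by
  convention and the span collapses to zero, so \<open>V\<close> has to be finite wherever
  generators must lie in their own span.\<close>

definition int_span :: "complex set \<Rightarrow> complex set" where
  "int_span V = {\<Sum>v\<in>V. of_int (c v) * v | c. True}"

lemma int_spanI: "x = (\<Sum>v\<in>V. of_int (c v) * v) \<Longrightarrow> x \<in> int_span V"
  unfolding int_span_def by blast

lemma int_span_base:
  assumes "finite V" "v \<in> V"
  shows "v \<in> int_span V"
proof -
  have "(\<Sum>u\<in>V. of_int (if u = v then 1 else 0) * u) = v"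
    using assms by (simp add: if_distrib[of of_int] if_distrib[of "\<lambda>t. t * _"] sum.delta cong: if_cong)
  then show ?thesis by (intro int_spanI) (rule sym)
qed

lemma int_span_add: "x \<in> int_span V \<Longrightarrow> y \<in> int_span V \<Longrightarrow> x + y \<in> int_span V"
proof -
  assume "x \<in> int_span V" "y \<in> int_span V"
  then obtain c d where "x = (\<Sum>v\<in>V. of_int (c v) * v)" "y = (\<Sum>v\<in>V. of_int (d v) * v)"
    unfolding int_span_def by blast
  then have "x + y = (\<Sum>v\<in>V. of_int (c v + d v) * v)"
    by (simp add: sum.distrib algebra_simps)
  then show ?thesis by (rule int_spanI)
qed

lemma int_span_mult_int: "x \<in> int_span V \<Longrightarrow> of_int k * x \<in> int_span V"
proof -
  assume "x \<in> int_span V"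
  then obtain c where "x = (\<Sum>v\<in>V. of_int (c v) * v)"
    unfolding int_span_def by blast
  then have "of_int k * x = (\<Sum>v\<in>V. of_int (k * c v) * v)"
    by (simp add: sum_distrib_left algebra_simps)
  then show ?thesis by (rule int_spanI)
qed

lemma int_span_0 [simp]: "0 \<in> int_span V"
  unfolding int_span_def by (auto intro!: exI[of _ "\<lambda>_. 0"])

lemma int_span_sum: "(\<And>i. i \<in> I \<Longrightarrow> g i \<in> int_span V) \<Longrightarrow> sum g I \<in> int_span V"
  by (induction I rule: infinite_finite_induct) (auto intro: int_span_add)

text \<open>Multiplication by \<open>x\<close> is additive, so only generators need checking. Source
  and target spans are kept apart because powers of one number are later mapped into products of
  powers of two.\<close>

lemma int_span_mult_stable:
  assumes "\<And>v. v \<in> V \<Longrightarrow> x * v \<in> int_span W" and "y \<in> int_span V"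
  shows "x * y \<in> int_span W"
proof -
  obtain c where "y = (\<Sum>v\<in>V. of_int (c v) * v)"
    using assms(2) unfolding int_span_def by blast
  then have "x * y = (\<Sum>v\<in>V. of_int (c v) * (x * v))"
    by (simp add: sum_distrib_left algebra_simps)
  also have "\<dots> \<in> int_span W"
    using assms(1) by (intro int_span_sum int_span_mult_int)
  finally show ?thesis .
qed

text \<open>The coordinates of \<open>x * v\<close> form an integer matrix having \<open>x\<close> as an eigenvalue.\<close>

lemma algebraic_int_if_stable:
  assumes fin: "finite V" and v0: "v0 \<in> V" "v0 \<noteq> 0"
    and stable: "\<And>v. v \<in> V \<Longrightarrow> x * v \<in> int_span V"
  shows "algebraic_int x"
proof -
  obtain vs where vs: "set vs = V" "distinct vs"
    using fin finite_distinct_list by blast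
  define n where "n = length vs"
  have "\<forall>v\<in>V. \<exists>c. x * v = (\<Sum>u\<in>V. of_int (c u) * u)"
    using stable unfolding int_span_def by blast
  then obtain c where c: "\<And>v. v \<in> V \<Longrightarrow> x * v = (\<Sum>u\<in>V. of_int (c v u) * u)"
    by metis
  define M :: "int mat" where "M = mat n n (\<lambda>(i, j). c (vs ! i) (vs ! j))"
  define A :: "complex mat" where "A = map_mat of_int M"
  have M: "M \<in> carrier_mat n n" and A: "A \<in> carrier_mat n n"
    by (auto simp: M_def A_def)
  define w where "w = vec n (\<lambda>i. vs ! i)"
  have inj: "inj_on ((!) vs) {..<n}"
    using vs n_def by (simp add: inj_on_nth)
  have img: "(!) vs ` {..<n} = V"
    using vs n_def by (auto simp: set_conv_nth)
  have "A *\<^sub>v w = x \<cdot>\<^sub>v w"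
  proof
    fix i assume "i < dim_vec (x \<cdot>\<^sub>v w)"
    then have i: "i < n" by (simp add: w_def)
    then have vi: "vs ! i \<in> V" using vs n_def by auto
    have "(A *\<^sub>v w) $ i = (\<Sum>j<n. of_int (c (vs ! i) (vs ! j)) * vs ! j)"
      using i by (simp add: A_def M_def w_def scalar_prod_def atLeast0LessThan)
    also have "\<dots> = (\<Sum>u\<in>V. of_int (c (vs ! i) u) * u)"
      unfolding img[symmetric] using inj by (simp add: sum.reindex)
    also have "\<dots> = (x \<cdot>\<^sub>v w) $ i"
      using i c[OF vi] by (simp add: w_def)
    finally show "(A *\<^sub>v w) $ i = (x \<cdot>\<^sub>v w) $ i" .
  qed (use A in \<open>auto simp: w_def\<close>)
  moreover have "w \<noteq> 0\<^sub>v n"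
  proof
    assume w0: "w = 0\<^sub>v n"
    obtain i where i: "i < n" "vs ! i = v0"
      using v0 vs n_def by (metis in_set_conv_nth)
    have "w $ i = v0" using i by (simp add: w_def)
    with w0 i v0 show False by simp
  qed
  ultimately have "eigenvalue A x"
    unfolding eigenvalue_def eigenvector_def using A by (auto simp: w_def intro!: exI[of _ w])
  then have "poly (char_poly A) x = 0"
    using eigenvalue_root_char_poly[OF A] by simp
  moreover have "char_poly A = map_poly of_int (char_poly M)"
    unfolding A_def by (rule of_int_hom.char_poly_hom[OF M])
  moreover have "lead_coeff (char_poly M) = 1"
    using degree_monic_char_poly[OF M] by simp
  ultimately show ?thesis
    unfolding algebraic_int_altdef_ipoly by auto
qed

text \<open>A monic integer equation can be solved for its top power. Its degree is positive because
  the only monic constant, 1, has no root.\<close>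

lemma algebraic_int_power_in_int_span:
  assumes "algebraic_int (x :: complex)"
  obtains n where "n > 0" "x ^ n \<in> int_span ((\<lambda>i. x ^ i) ` {..<n})"
proof -
  obtain p where p: "poly (map_poly of_int p) x = 0" "lead_coeff p = 1"
    using assms unfolding algebraic_int_altdef_ipoly by blast
  define n where "n = degree p"
  have n: "n > 0"
  proof (rule ccontr)
    assume "\<not> n > 0"
    then obtain a where "p = [:a:]" using n_def degree_eq_zeroE by auto
    with p show False by simp
  qed
  have "degree (map_poly of_int p :: complex poly) = n"
    by (simp add: n_def)
  then have "0 = (\<Sum>i\<le>n. of_int (coeff p i) * x ^ i)"
    using p(1) by (simp add: poly_altdef)
  also have "\<dots> = x ^ n + (\<Sum>i<n. of_int (coeff p i) * x ^ i)"
    using p(2) by (simp add: lessThan_Suc_atMost[symmetric] n_def)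
  finally have "x ^ n = (\<Sum>i<n. of_int (- coeff p i) * x ^ i)"
    by (simp add: sum_negf eq_neg_iff_add_eq_0)
  also have "\<dots> \<in> int_span ((\<lambda>i. x ^ i) ` {..<n})"
    by (intro int_span_sum int_span_mult_int int_span_base) auto
  finally show ?thesis using that n by blast
qed

text \<open>The finitely many products \<open>x ^ i * y ^ j\<close> below the two degrees contain 1,
  and their span is stable under multiplication by \<open>x\<close> and by \<open>y\<close>, hence
  by the sum and the product.\<close>

lemma
  assumes x: "algebraic_int (x :: complex)" and y: "algebraic_int y"
  shows algebraic_int_plus: "algebraic_int (x + y)"
    and algebraic_int_times: "algebraic_int (x * y)"
proof -
  \<comment> \<open>Stated for generic \<open>a\<close> and \<open>b\<close>, so that it serves
    \<open>x\<close> and, after exchanging the factors, \<open>y\<close>. Only the exponent that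
    reaches the degree needs the monic equation.\<close>
  have *: "a * v \<in> int_span ((\<lambda>(i, j). a ^ i * b ^ j) ` ({..<n} \<times> {..<m}))"
    if n: "n > 0" "a ^ n \<in> int_span ((\<lambda>i. a ^ i) ` {..<n})"
      and v: "v \<in> (\<lambda>(i, j). a ^ i * b ^ j) ` ({..<n} \<times> {..<m})" for a b v :: complex and n m
  proof -
    obtain i j where ij: "i < n" "j < m" "v = a ^ i * b ^ j" using v by auto
    let ?W = "(\<lambda>(i, j). a ^ i * b ^ j) ` ({..<n} \<times> {..<m})"
    show ?thesis
    proof (cases "Suc i < n")
      case True
      then have "a ^ Suc i * b ^ j \<in> ?W" using ij by force
      then show ?thesis using ij by (intro int_span_base) (auto simp: mult_ac)
    next
      case False
      then have "Suc i = n" using ij by simp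
      then have "a * v = b ^ j * a ^ n" using ij by (auto simp: mult_ac)
      also have "\<dots> \<in> int_span ?W"
      proof (rule int_span_mult_stable[OF _ n(2)])
        fix u assume "u \<in> (\<lambda>i. a ^ i) ` {..<n}"
        then obtain k where "k < n" "u = a ^ k" by auto
        then have "b ^ j * u \<in> ?W" using ij by (auto intro!: image_eqI[of _ _ "(k, j)"])
        then show "b ^ j * u \<in> int_span ?W" by (intro int_span_base) auto
      qed
      finally show ?thesis .
    qed
  qed
  obtain n where n: "n > 0" "x ^ n \<in> int_span ((\<lambda>i. x ^ i) ` {..<n})"
    using algebraic_int_power_in_int_span[OF x] .
  obtain m where m: "m > 0" "y ^ m \<in> int_span ((\<lambda>i. y ^ i) ` {..<m})"
    using algebraic_int_power_in_int_span[OF y] .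
  define V where "V = (\<lambda>(i, j). x ^ i * y ^ j) ` ({..<n} \<times> {..<m})"
  have V': "V = (\<lambda>(j, i). y ^ j * x ^ i) ` ({..<m} \<times> {..<n})"
    unfolding V_def by (force simp: mult_ac)
  have xV: "x * v \<in> int_span V" if "v \<in> V" for v
    using *[OF n, of v y m] that unfolding V_def by blast
  have yV: "y * v \<in> int_span V" if "v \<in> V" for v
    using *[OF m, of v x n] that unfolding V' by blast
  have fin: "finite V" unfolding V_def by simp
  have one: "1 \<in> V" unfolding V_def using n m by force
  show "algebraic_int (x + y)"
    by (rule algebraic_int_if_stable[OF fin one])
      (use xV yV in \<open>auto simp: distrib_right intro: int_span_add\<close>)
  show "algebraic_int (x * y)"
  proof (rule algebraic_int_if_stable[OF fin one])
    fix v assume "v \<in> V"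
    then have "x * (y * v) \<in> int_span V" by (intro int_span_mult_stable[OF xV yV])
    then show "x * y * v \<in> int_span V" by (simp add: mult.assoc)
  qed simp
qed

lemma algebraic_int_power:
  "algebraic_int (x :: complex) \<Longrightarrow> algebraic_int (x ^ k)"
  by (induction k) (auto intro: algebraic_int_times int_imp_algebraic_int)

lemma algebraic_int_sum:
  "(\<And>i. i \<in> I \<Longrightarrow> algebraic_int (g i :: complex)) \<Longrightarrow> algebraic_int (sum g I)"
  by (induction I rule: infinite_finite_induct) (auto intro: algebraic_int_plus)

lemma algebraic_int_root_of_unity:
  assumes "(x :: complex) ^ n = 1" "n > 0"
  shows "algebraic_int x"
proof -
  have "algebraic_int (1 :: complex)" by (intro int_imp_algebraic_int) simp
  moreover have "poly (monom 1 n) x = 1" using assms(1) by (simp add: poly_monom)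
  ultimately show ?thesis
    by (rule algebraic_int_root) (use assms(2) in \<open>simp_all add: degree_monom_eq\<close>)
qed

section \<open>Congruences modulo a rational prime between algebraic integers\<close>

definition alg_cong :: "nat \<Rightarrow> complex \<Rightarrow> complex \<Rightarrow> bool" where
  "alg_cong p x y \<longleftrightarrow> (\<exists>r. algebraic_int r \<and> x - y = of_nat p * r)"

lemma alg_cong_refl [simp]: "alg_cong p x x"
  unfolding alg_cong_def by (auto intro!: exI[of _ 0])

lemma alg_cong_sym: "alg_cong p x y \<Longrightarrow> alg_cong p y x"
  unfolding alg_cong_def by (metis algebraic_int_minus minus_diff_eq mult_minus_right)

lemma alg_cong_trans:
  assumes "alg_cong p x y" "alg_cong p y z"
  shows "alg_cong p x z"
proof -
  obtain r r' where "algebraic_int r" "x - y = of_nat p * r" "algebraic_int r'" "y - z = of_nat p * r'"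
    using assms unfolding alg_cong_def by blast
  moreover from this have "x - z = of_nat p * (r + r')"
    by (simp add: algebra_simps)
  ultimately show ?thesis unfolding alg_cong_def by (meson algebraic_int_plus)
qed

lemma alg_cong_add:
  assumes "alg_cong p x y" "alg_cong p x' y'"
  shows "alg_cong p (x + x') (y + y')"
proof -
  obtain r r' where "algebraic_int r" "x - y = of_nat p * r" "algebraic_int r'" "x' - y' = of_nat p * r'"
    using assms unfolding alg_cong_def by blast
  moreover from this have "x + x' - (y + y') = of_nat p * (r + r')"
    by (simp add: algebra_simps)
  ultimately show ?thesis unfolding alg_cong_def by (meson algebraic_int_plus)
qed

lemma alg_cong_mult:
  assumes "algebraic_int z" "alg_cong p x y"
  shows "alg_cong p (z * x) (z * y)"
proof -
  obtain r where "algebraic_int r" "x - y = of_nat p * r"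
    using assms unfolding alg_cong_def by blast
  moreover from this have "z * x - z * y = of_nat p * (z * r)"
    by (metis mult.left_commute right_diff_distrib)
  ultimately show ?thesis unfolding alg_cong_def using assms by (meson algebraic_int_times)
qed

lemma alg_cong_sum:
  "(\<And>i. i \<in> I \<Longrightarrow> alg_cong p (g i) (h i)) \<Longrightarrow> alg_cong p (sum g I) (sum h I)"
  by (induction I rule: infinite_finite_induct) (auto intro: alg_cong_add)

text \<open>The Frobenius map is additive modulo \<open>p\<close>: the prime divides every inner
  binomial coefficient, and the cofactor \<open>r\<close> is again an algebraic integer.\<close>

lemma alg_cong_power_add:
  assumes p: "prime p" and x: "algebraic_int x" and y: "algebraic_int y"
  shows "alg_cong p ((x + y) ^ p) (x ^ p + y ^ p)"
proof -
  have p0: "p > 0" using p prime_gt_0_nat by blast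
  define r where "r = (\<Sum>k\<in>{0<..<p}. of_nat ((p choose k) div p) * x ^ k * y ^ (p - k))"
  have "(x + y) ^ p = (\<Sum>k\<le>p. of_nat (p choose k) * x ^ k * y ^ (p - k))"
    by (rule binomial_ring)
  also have "{..p} = insert 0 (insert p {0<..<p})" by auto
  also have "(\<Sum>k\<in>\<dots>. of_nat (p choose k) * x ^ k * y ^ (p - k)) =
    x ^ p + y ^ p + (\<Sum>k\<in>{0<..<p}. of_nat (p choose k) * x ^ k * y ^ (p - k))"
    using p0 by simp
  also have "(\<Sum>k\<in>{0<..<p}. of_nat (p choose k) * x ^ k * y ^ (p - k)) = of_nat p * r"
    unfolding r_def sum_distrib_left
  proof (rule sum.cong[OF refl])
    fix k assume "k \<in> {0<..<p}"
    then have "p dvd p choose k" using p by (intro dvd_choose_prime) auto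
    then have "p * ((p choose k) div p) = p choose k" by simp
    then have "of_nat (p choose k) = (of_nat (p * ((p choose k) div p)) :: complex)"
      by simp
    then show "of_nat (p choose k) * x ^ k * y ^ (p - k) =
        of_nat p * (of_nat ((p choose k) div p) * x ^ k * y ^ (p - k))"
      by (simp only: of_nat_mult mult.assoc)
  qed
  finally have "(x + y) ^ p - (x ^ p + y ^ p) = of_nat p * r" by simp
  moreover have "algebraic_int r"
    unfolding r_def using x y
    by (intro algebraic_int_sum algebraic_int_times algebraic_int_power) (auto intro: int_imp_algebraic_int)
  ultimately show ?thesis unfolding alg_cong_def by blast
qed

lemma alg_cong_power_sum:
  assumes p: "prime p" and fin: "finite I" and g: "\<And>i. i \<in> I \<Longrightarrow> algebraic_int (g i)"
  shows "alg_cong p ((\<Sum>i\<in>I. g i) ^ p) (\<Sum>i\<in>I. g i ^ p)"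
  using fin g
proof (induction I)
  case empty
  then show ?case using p prime_gt_0_nat[OF p] by (simp add: power_0_left)
next
  case (insert i I)
  have "alg_cong p ((g i + sum g I) ^ p) (g i ^ p + sum g I ^ p)"
    using insert by (intro alg_cong_power_add p algebraic_int_sum) auto
  moreover have "alg_cong p (g i ^ p + sum g I ^ p) (g i ^ p + (\<Sum>i\<in>I. g i ^ p))"
    using insert by (intro alg_cong_add) auto
  ultimately have "alg_cong p ((g i + sum g I) ^ p) (g i ^ p + (\<Sum>i\<in>I. g i ^ p))"
    by (rule alg_cong_trans)
  then show ?case by (simp only: sum.insert[OF insert(1,2)])
qed

text \<open>Fermat's little theorem, extended to multiples of \<open>p\<close> and to negative
  integers.\<close>

lemma alg_cong_Ints_power:
  assumes p: "prime p" and z: "z \<in> \<int>"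
  shows "alg_cong p (z ^ p) z"
proof -
  obtain a where a: "z = of_int a" using z Ints_cases by blast
  have "int p dvd a ^ p - a"
  proof -
    have "[a ^ p = a] (mod int p)"
    proof (cases "int p dvd a")
      case True
      moreover from this have "int p dvd a ^ p"
        using dvd_power[OF disjI1[OF prime_gt_0_nat[OF p]]] dvd_trans by blast
      ultimately show ?thesis by (simp add: cong_iff_dvd_diff)
    next
      case False
      \<comment> \<open>Fermat's theorem is applied to natural numbers, so \<open>a\<close> is
        replaced by its nonnegative residue.\<close>
      define b where "b = nat (a mod int p)"
      have p0: "p > 0" using p prime_gt_0_nat by blast
      have b: "int b = a mod int p" using p0 by (simp add: b_def)
      have "\<not> p dvd b"
        using False b dvd_mod_iff[of "int p" "int p" a] int_dvd_int_iff[of p b] by simp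
      then have "[b ^ (p - 1) = 1] (mod p)" using fermat_theorem p by blast
      then have "[b ^ (p - 1) * b = 1 * b] (mod p)" by (rule cong_scalar_right)
      then have "[b ^ p = b] (mod p)" using power_minus_mult[OF p0, of b] by simp
      then have "[int b ^ p = int b] (mod int p)"
        using cong_int_iff[of "b ^ p" b p] by simp
      moreover have "[a = int b] (mod int p)" using b by (simp add: cong_def)
      ultimately show ?thesis
        by (meson cong_pow cong_sym cong_trans)
    qed
    then show ?thesis by (simp add: cong_iff_dvd_diff)
  qed
  then obtain k where "a ^ p - a = int p * k" by blast
  then have "z ^ p - z = of_nat p * of_int k"
    unfolding a of_int_power[symmetric] of_int_diff[symmetric] by simp
  then show ?thesis unfolding alg_cong_def by (auto intro!: exI[of _ "of_int k"] int_imp_algebraic_int)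
qed

subsection \<open>Traces of complex matrices\<close>

definition mat_tr :: "'a::comm_ring_1 mat \<Rightarrow> 'a" where
  "mat_tr A = (\<Sum>i<dim_row A. A $$ (i, i))"

lemma index_mult_mat_sum:
  assumes "A \<in> carrier_mat n n" "B \<in> carrier_mat n n" "i < n" "j < n"
  shows "(A * B) $$ (i, j) = (\<Sum>k<n. A $$ (i, k) * B $$ (k, j))"
  using assms by (simp add: scalar_prod_def atLeast0LessThan)

lemma mat_tr_comm:
  assumes "A \<in> carrier_mat n n" "B \<in> carrier_mat n n"
  shows "mat_tr (A * B) = mat_tr (B * A)"
proof -
  have "mat_tr (A * B) = (\<Sum>i<n. \<Sum>k<n. A $$ (i, k) * B $$ (k, i))"
    using assms by (auto simp: mat_tr_def index_mult_mat_sum simp del: index_mult_mat(1) intro!: sum.cong)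
  also have "\<dots> = (\<Sum>k<n. \<Sum>i<n. B $$ (k, i) * A $$ (i, k))"
    by (subst sum.swap) (simp add: mult.commute)
  also have "\<dots> = mat_tr (B * A)"
    using assms by (auto simp: mat_tr_def index_mult_mat_sum simp del: index_mult_mat(1) intro!: sum.cong)
  finally show ?thesis .
qed

text \<open>A Schur decomposition makes the trace the sum of the eigenvalues with
  multiplicity.\<close>

lemma mat_tr_Ints_if_eigenvalues:
  fixes A :: "complex mat"
  assumes A: "A \<in> carrier_mat n n" and ev: "\<And>e. eigenvalue A e \<Longrightarrow> e \<in> \<int>"
  shows "mat_tr A \<in> \<int>"
proof -
  obtain es where es: "char_poly A = (\<Prod>a\<leftarrow>es. [:- a, 1:])"
    using char_poly_factorized[OF A] by blast
  obtain B P Q where "schur_decomposition A es = (B, P, Q)"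
    by (metis prod_cases3)
  from schur_decomposition[OF A es this]
  have sim: "similar_mat_wit A B P Q" and diag: "diag_mat B = es" by auto
  note w = similar_mat_witD2[OF A sim]
  have "mat_tr A = mat_tr (P * (B * Q))"
    using w by (simp add: assoc_mult_mat[of P n n B n Q n])
  also have "\<dots> = mat_tr (B * Q * P)"
    using w by (intro mat_tr_comm[of _ n]) auto
  also have "B * Q * P = B"
    using w by (simp add: assoc_mult_mat[of B n n Q n P n])
  also have "mat_tr B = sum_list es"
    unfolding diag[symmetric] diag_mat_def mat_tr_def
    by (simp add: sum_list_distinct_conv_sum_set atLeast0LessThan)
  also have "\<dots> \<in> \<int>"
  proof -
    have "e \<in> \<int>" if "e \<in> set es" for e
    proof -
      have "poly (char_poly A) e = 0"
        using that unfolding es by (auto simp: poly_prod_list prod_list_zero_iff)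
      then show ?thesis using eigenvalue_root_char_poly[OF A] ev by blast
    qed
    then show ?thesis by (induction es) (auto intro: Ints_add)
  qed
  finally show ?thesis .
qed

lemma smult_mat_mult_vec:
  assumes "A \<in> carrier_mat nr nc" "v \<in> carrier_vec nc"
  shows "(k \<cdot>\<^sub>m A) *\<^sub>v v = (k :: 'a :: comm_ring_1) \<cdot>\<^sub>v (A *\<^sub>v v)"
  using assms by (intro eq_vecI) (auto simp: smult_scalar_prod_distrib[of _ nc])

text \<open>On an eigenvector of \<open>A * E\<close> with nonzero eigenvalue \<open>e\<close>, the
  matrix \<open>E\<close> acts as the scalar \<open>c\<close>. The vector is then an eigenvector of
  \<open>A\<close> for \<open>e / c\<close>, so \<open>e\<close> is \<open>c\<close> times an
  integer.\<close>

lemma mat_tr_commuting_quasi_idempotent: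
  fixes A E :: "complex mat"
  assumes A: "A \<in> carrier_mat n n" and E: "E \<in> carrier_mat n n"
    and ev: "\<And>e. eigenvalue A e \<Longrightarrow> e \<in> \<int>"
    and comm: "A * E = E * A" and idem: "E * E = of_int c \<cdot>\<^sub>m E"
  shows "mat_tr (A * E) \<in> \<int>"
proof (rule mat_tr_Ints_if_eigenvalues)
  show "A * E \<in> carrier_mat n n" using A E by simp
  fix e assume "eigenvalue (A * E) e"
  then obtain v where v: "v \<in> carrier_vec n" "v \<noteq> 0\<^sub>v n" and ew: "A * E *\<^sub>v v = e \<cdot>\<^sub>v v"
    unfolding eigenvalue_def eigenvector_def using A E by auto
  show "e \<in> \<int>"
  proof (cases "e = 0")
    case False
    \<comment> \<open>Applying \<open>E\<close> to the eigenvector equation and moving it past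
      \<open>A\<close> turns \<open>E * E\<close> into \<open>c\<close> times \<open>E\<close>;
      cancelling \<open>e\<close> shows that \<open>E\<close> acts on \<open>v\<close> as
      \<open>c\<close>.\<close>
    have "e \<cdot>\<^sub>v (E *\<^sub>v v) = E *\<^sub>v (e \<cdot>\<^sub>v v)"
      using mult_mat_vec[OF E v(1)] by simp
    also have "\<dots> = E * (A * E) *\<^sub>v v"
      unfolding ew[symmetric] using A E v by (simp add: assoc_mult_mat_vec[of E n n "A * E" n])
    also have "E * (A * E) = A * (E * E)"
      unfolding assoc_mult_mat[OF E A E, symmetric] comm[symmetric] by (rule assoc_mult_mat[OF A E E])
    also have "\<dots> = of_int c \<cdot>\<^sub>m (A * E)"
      unfolding idem by (rule mult_smult_distrib[OF A E])
    also have "\<dots> *\<^sub>v v = of_int c \<cdot>\<^sub>v (A * E *\<^sub>v v)"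
      by (rule smult_mat_mult_vec[of _ n n]) (use A E v in auto)
    also have "\<dots> = e \<cdot>\<^sub>v (of_int c \<cdot>\<^sub>v v)"
      unfolding ew by (simp add: smult_smult_assoc mult.commute)
    finally have "E *\<^sub>v v = of_int c \<cdot>\<^sub>v v"
      using False by (metis smult_smult_assoc left_inverse one_smult_vec)
    then have *: "of_int c \<cdot>\<^sub>v (A *\<^sub>v v) = e \<cdot>\<^sub>v v"
      using ew A E v mult_mat_vec[OF A v(1)] by (simp add: assoc_mult_mat_vec[of A n n E n])
    \<comment> \<open>For \<open>c = 0\<close> the equation \<open>*\<close> would make
      \<open>e\<close> times \<open>v\<close> vanish although neither factor does.\<close>
    have "c \<noteq> 0"
    proof
      assume "c = 0"
      obtain i where i: "i < n" "v $ i \<noteq> 0"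
        using v by (metis carrier_vecD eq_vecI index_zero_vec)
      have "(of_int c \<cdot>\<^sub>v (A *\<^sub>v v)) $ i = e * v $ i" using * i v by simp
      moreover have "(of_int c \<cdot>\<^sub>v (A *\<^sub>v v)) $ i = 0" using \<open>c = 0\<close> i A by simp
      ultimately show False using i False by simp
    qed
    then have "A *\<^sub>v v = (e / of_int c) \<cdot>\<^sub>v v"
      using arg_cong[OF *, of "\<lambda>u. inverse (of_int c) \<cdot>\<^sub>v u"]
      by (simp add: smult_smult_assoc divide_inverse mult.commute)
    then have "eigenvalue A (e / of_int c)"
      unfolding eigenvalue_def eigenvector_def using v A by auto
    then have "of_int c * (e / of_int c) \<in> \<int>"
      using ev by (intro Ints_mult) auto
    then show ?thesis using \<open>c \<noteq> 0\<close> by simp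
  qed simp
qed

text \<open>The preceding lemma for the identity matrix, whose only possible eigenvalue is
  1.\<close>

lemma mat_tr_quasi_idempotent:
  fixes E :: "complex mat"
  assumes E: "E \<in> carrier_mat n n" and idem: "E * E = of_int c \<cdot>\<^sub>m E"
  shows "mat_tr E \<in> \<int>"
proof -
  have "mat_tr (1\<^sub>m n * E) \<in> \<int>"
  proof (rule mat_tr_commuting_quasi_idempotent[OF _ E _ _ idem])
    fix e assume "eigenvalue (1\<^sub>m n :: complex mat) e"
    then obtain v where v: "v \<in> carrier_vec n" "v \<noteq> 0\<^sub>v n" "v = e \<cdot>\<^sub>v v"
      unfolding eigenvalue_def eigenvector_def by auto
    then obtain i where i: "i < n" "v $ i \<noteq> 0" by (metis carrier_vecD eq_vecI index_zero_vec)
    then have "v $ i = e * v $ i" using v by (metis carrier_vecD index_smult_vec(1))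
    then show "e \<in> \<int>" using i by simp
  qed (use E in auto)
  then show ?thesis using E by simp
qed

section \<open>Restriction to a generalised eigenspace\<close>

text \<open>Induction starting from the lower left corner of the block. In entry
  \<open>(i, j)\<close> of both products, triangularity removes the terms on one side and the
  induction hypothesis those on the other. What remains is the difference of two distinct diagonal
  entries times \<open>X $$ (i, j)\<close>.\<close>

lemma commuting_triangular_block_zero:
  fixes B X :: "'a::idom mat"
  assumes B: "B \<in> carrier_mat n n" "upper_triangular B" and X: "X \<in> carrier_mat n n"
    and comm: "X * B = B * X"
    and diff: "\<And>i j. j < m \<Longrightarrow> m \<le> i \<Longrightarrow> i < n \<Longrightarrow> B $$ (i, i) \<noteq> B $$ (j, j)"
    and ij: "j < m" "m \<le> i" "i < n"
  shows "X $$ (i, j) = 0"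
  using ij
proof (induction "j + (n - i)" arbitrary: i j rule: less_induct)
  case (less i j)
  note ij = less.prems
  have "(X * B) $$ (i, j) = (\<Sum>k<n. X $$ (i, k) * B $$ (k, j))"
    using B X ij by (intro index_mult_mat_sum) auto
  also have "\<dots> = (\<Sum>k<n. if k = j then X $$ (i, j) * B $$ (j, j) else 0)"
  proof (rule sum.cong[OF refl])
    fix k assume k: "k \<in> {..<n}"
    consider "k < j" | "k = j" | "k > j" by linarith
    then show "X $$ (i, k) * B $$ (k, j) = (if k = j then X $$ (i, j) * B $$ (j, j) else 0)"
    proof cases
      case 1
      then show ?thesis using less.hyps[of k i] ij by simp
    next
      case 3
      then have "B $$ (k, j) = 0" using B k by (auto simp: upper_triangular_def)
      then show ?thesis using 3 by simp
    qed simp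
  qed
  also have "\<dots> = X $$ (i, j) * B $$ (j, j)" using ij by simp
  finally have L: "(X * B) $$ (i, j) = X $$ (i, j) * B $$ (j, j)" .
  have "(B * X) $$ (i, j) = (\<Sum>k<n. B $$ (i, k) * X $$ (k, j))"
    using B X ij by (intro index_mult_mat_sum) auto
  also have "\<dots> = (\<Sum>k<n. if k = i then B $$ (i, i) * X $$ (i, j) else 0)"
  proof (rule sum.cong[OF refl])
    fix k assume k: "k \<in> {..<n}"
    consider "k < i" | "k = i" | "k > i" by linarith
    then show "B $$ (i, k) * X $$ (k, j) = (if k = i then B $$ (i, i) * X $$ (i, j) else 0)"
    proof cases
      case 1
      then have "B $$ (i, k) = 0" using B ij by (auto simp: upper_triangular_def)
      then show ?thesis using 1 by simp
    next
      case 3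
      then show ?thesis using less.hyps[of j k] ij k by simp
    qed simp
  qed
  also have "\<dots> = B $$ (i, i) * X $$ (i, j)" using ij by simp
  finally have "B $$ (i, i) * X $$ (i, j) = X $$ (i, j) * B $$ (j, j)"
    using L comm by simp
  then have "(B $$ (i, i) - B $$ (j, j)) * X $$ (i, j) = 0"
    by (simp add: algebra_simps)
  then show ?case using diff ij by simp
qed

text \<open>The map \<open>\<phi>\<close> restricts an operator commuting with \<open>A\<close> to the generalised eigenspace of \<open>l\<close>:
  in a Schur basis listing \<open>l\<close> first, such an operator is block triangular.\<close>

lemma generalised_eigenspace_restriction:
  fixes A :: "complex mat"
  assumes A: "A \<in> carrier_mat n n" and l: "eigenvalue A l"
  obtains m \<phi> where "m > 0" "mat_tr (\<phi> A) = of_nat m * l"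
    "\<And>N. \<phi> N \<in> carrier_mat m m"
    "\<And>N N'. N \<in> carrier_mat n n \<Longrightarrow> N' \<in> carrier_mat n n \<Longrightarrow> \<phi> (N + N') = \<phi> N + \<phi> N'"
    "\<And>c N. N \<in> carrier_mat n n \<Longrightarrow> \<phi> (c \<cdot>\<^sub>m N) = c \<cdot>\<^sub>m \<phi> N"
    "\<And>N N'. N \<in> carrier_mat n n \<Longrightarrow> N' \<in> carrier_mat n n \<Longrightarrow> N' * A = A * N' \<Longrightarrow>
      \<phi> (N * N') = \<phi> N * \<phi> N'"
proof -
  obtain as where as: "char_poly A = (\<Prod>a\<leftarrow>as. [:- a, 1:])" "length as = n"
    using char_poly_factorized[OF A] by blast
  \<comment> \<open>The Schur decomposition follows any prescribed order of the roots; here all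
    \<open>m\<close> copies of \<open>l\<close> come first.\<close>
  define es where "es = filter (\<lambda>a. a = l) as @ filter (\<lambda>a. a \<noteq> l) as"
  define m where "m = length (filter (\<lambda>a. a = l) as)"
  have mset: "mset es = mset as" unfolding es_def by simp
  then have es: "char_poly A = (\<Prod>a\<leftarrow>es. [:- a, 1:])"
    unfolding as(1) prod_mset_prod_list[symmetric] by (simp only: mset_map)
  have len: "length es = n" using mset as(2) by (metis mset_eq_length)
  have mn: "m \<le> n" unfolding m_def using as(2) length_filter_le by blast
  have es1: "es ! i = l" if "i < m" for i
    using that nth_mem[of i "filter (\<lambda>a. a = l) as"] unfolding es_def m_def by (auto simp: nth_append)
  have es2: "es ! i \<noteq> l" if "m \<le> i" "i < n" for i
  proof -
    have "i - m < length (filter (\<lambda>a. a \<noteq> l) as)"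
      using that len unfolding es_def m_def by simp
    then have "filter (\<lambda>a. a \<noteq> l) as ! (i - m) \<in> set (filter (\<lambda>a. a \<noteq> l) as)"
      by (rule nth_mem)
    then show ?thesis using that unfolding es_def m_def by (auto simp: nth_append)
  qed
  have "poly (char_poly A) l = 0" using eigenvalue_root_char_poly[OF A] l by simp
  then have "l \<in> set as" unfolding as by (auto simp: poly_prod_list prod_list_zero_iff)
  then have m: "m > 0" unfolding m_def by (auto simp: filter_empty_conv)
  obtain B P Q where "schur_decomposition A es = (B, P, Q)"
    by (metis prod_cases3)
  from schur_decomposition[OF A es this]
  have sim: "similar_mat_wit A B P Q" and diag: "diag_mat B = es" and ut: "upper_triangular B" by auto
  note w = similar_mat_witD2[OF A sim]
  have P: "P \<in> carrier_mat n n" and Q: "Q \<in> carrier_mat n n" and B: "B \<in> carrier_mat n n"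
    and PQ: "P * Q = 1\<^sub>m n" and QP: "Q * P = 1\<^sub>m n" and APBQ: "A = P * B * Q"
    using w by auto
  have Bii: "B $$ (i, i) = es ! i" if "i < n" for i
    using that B unfolding diag[symmetric] diag_mat_def by simp
  \<comment> \<open>\<open>conj N\<close> is \<open>N\<close> in the Schur basis, and
    \<open>\<phi> N\<close> is its upper left block of size \<open>m\<close>.\<close>
  define conj where "conj N = Q * N * P" for N
  define \<phi> where "\<phi> N = mat m m (\<lambda>ij. conj N $$ ij)" for N
  have conj_carrier: "conj N \<in> carrier_mat n n" if "N \<in> carrier_mat n n" for N
    using that P Q unfolding conj_def by simp
  have conj_mult: "conj (N * N') = conj N * conj N'"
    if N: "N \<in> carrier_mat n n" "N' \<in> carrier_mat n n" for N N'
  proof -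
    have "conj N * conj N' = Q * N * (P * (Q * N' * P))"
      unfolding conj_def using N P Q by (intro assoc_mult_mat[of _ n n _ n _ n]) auto
    also have "P * (Q * N' * P) = P * Q * (N' * P)"
      using N P Q by (simp add: assoc_mult_mat[of _ n n _ n _ n])
    also have "\<dots> = N' * P" unfolding PQ using N P by simp
    also have "Q * N * (N' * P) = conj (N * N')"
      unfolding conj_def using N P Q by (simp add: assoc_mult_mat[of _ n n _ n _ n])
    finally show ?thesis ..
  qed
  have conj_A: "conj A = B"
  proof -
    have "conj A = Q * P * B * (Q * P)"
      unfolding conj_def APBQ using P Q B by (simp add: assoc_mult_mat[of _ n n _ n _ n])
    then show ?thesis unfolding QP using B by simp
  qed
  have zero: "conj N $$ (i, j) = 0"
    if N: "N \<in> carrier_mat n n" "N * A = A * N" and ij: "j < m" "m \<le> i" "i < n" for N i j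
  proof (rule commuting_triangular_block_zero[OF B ut conj_carrier[OF N(1)] _ _ ij])
    show "conj N * B = B * conj N"
      using conj_mult[OF N(1) A] conj_mult[OF A N(1)] N(2) conj_A by simp
    fix i j assume "j < m" "m \<le> i" "i < n"
    then show "B $$ (i, i) \<noteq> B $$ (j, j)" using Bii es1 es2 mn by simp
  qed
  show thesis
  proof (rule that[OF m])
    show "mat_tr (\<phi> A) = of_nat m * l"
      using mn by (simp add: mat_tr_def \<phi>_def conj_A Bii es1)
  next
    fix N :: "complex mat"
    show "\<phi> N \<in> carrier_mat m m" by (simp add: \<phi>_def)
  next
    fix N N' :: "complex mat" assume N: "N \<in> carrier_mat n n" "N' \<in> carrier_mat n n"
    have "conj (N + N') = conj N + conj N'"
      unfolding conj_def using N P Q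
      by (simp add: mult_add_distrib_mat[of _ n n] add_mult_distrib_mat[of _ n n])
    then show "\<phi> (N + N') = \<phi> N + \<phi> N'"
      using conj_carrier[OF N(1)] conj_carrier[OF N(2)] mn by (auto simp: \<phi>_def)
  next
    fix c and N :: "complex mat" assume N: "N \<in> carrier_mat n n"
    have "conj (c \<cdot>\<^sub>m N) = c \<cdot>\<^sub>m conj N"
      unfolding conj_def using N P Q
      by (simp add: mult_smult_distrib[of _ n n] mult_smult_assoc_mat[of _ n n])
    then show "\<phi> (c \<cdot>\<^sub>m N) = c \<cdot>\<^sub>m \<phi> N"
      using conj_carrier[OF N] mn by (auto simp: \<phi>_def)
  next
    fix N N' :: "complex mat"
    assume N: "N \<in> carrier_mat n n" "N' \<in> carrier_mat n n" and comm: "N' * A = A * N'"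
    show "\<phi> (N * N') = \<phi> N * \<phi> N'"
    proof (rule eq_matI)
      fix i j assume "i < dim_row (\<phi> N * \<phi> N')" "j < dim_col (\<phi> N * \<phi> N')"
      then have ij: "i < m" "j < m" by (auto simp: \<phi>_def)
      have "\<phi> (N * N') $$ (i, j) = (\<Sum>k<n. conj N $$ (i, k) * conj N' $$ (k, j))"
        using ij mn conj_mult[OF N] index_mult_mat_sum[OF conj_carrier[OF N(1)] conj_carrier[OF N(2)]]
        by (simp add: \<phi>_def)
      \<comment> \<open>The terms with \<open>k\<close> at least \<open>m\<close> contain entries of
        the lower left block of \<open>conj N'\<close>, which is zero; hence only the right factor
        has to commute with \<open>A\<close>.\<close>
      also have "\<dots> = (\<Sum>k<m. conj N $$ (i, k) * conj N' $$ (k, j))"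
        using mn zero[OF N(2) comm ij(2)] by (intro sum.mono_neutral_right) auto
      also have "\<dots> = (\<phi> N * \<phi> N') $$ (i, j)"
        using ij by (subst index_mult_mat_sum[of _ m]) (auto simp: \<phi>_def)
      finally show "\<phi> (N * N') $$ (i, j) = (\<phi> N * \<phi> N') $$ (i, j)" .
    qed (auto simp: \<phi>_def)
  qed
qed

subsection \<open>Integral Fourier transforms\<close>

lemma primitive_root_power_eq_iff:
  assumes n: "n > 0"
  defines "\<zeta> \<equiv> cis (2 * pi / real n)"
  shows "\<zeta> ^ n = 1" and "\<zeta> ^ j = \<zeta> ^ k \<longleftrightarrow> [j = k] (mod n)"
proof -
  show 1: "\<zeta> ^ n = 1" unfolding \<zeta>_def DeMoivre using n by simp
  have red: "\<zeta> ^ j = \<zeta> ^ (j mod n)" for j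
  proof -
    have "\<zeta> ^ j = \<zeta> ^ (n * (j div n) + j mod n)" by simp
    also have "\<dots> = \<zeta> ^ (j mod n)" unfolding power_add power_mult 1 by simp
    finally show ?thesis .
  qed
  have inj: "inj_on (\<lambda>k. cis (2 * pi * real k / real n)) {..<n}"
    using bij_betw_roots_unity[OF n] bij_betw_imp_inj_on by blast
  have pow: "\<zeta> ^ k = cis (2 * pi * real k / real n)" for k
    unfolding \<zeta>_def DeMoivre by (simp add: mult_ac)
  show "\<zeta> ^ j = \<zeta> ^ k \<longleftrightarrow> [j = k] (mod n)"
  proof
    assume "\<zeta> ^ j = \<zeta> ^ k"
    then have "\<zeta> ^ (j mod n) = \<zeta> ^ (k mod n)" using red by metis
    then show "[j = k] (mod n)"
      unfolding cong_def pow using inj n by (auto simp: inj_on_def)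
  next
    assume "[j = k] (mod n)"
    then show "\<zeta> ^ j = \<zeta> ^ k" unfolding cong_def using red by metis
  qed
qed

text \<open>A geometric sum whose ratio \<open>w\<close> is an \<open>n\<close>-th root of unity,
  equal to 1 exactly when the exponents agree modulo \<open>n\<close>.\<close>

lemma roots_of_unity_orthogonality:
  assumes n: "n > 0"
  defines "\<zeta> \<equiv> cis (2 * pi / real n)"
  shows "(\<Sum>l<n. (\<zeta> ^ l) ^ j * inverse (\<zeta> ^ l) ^ k) = (if [j = k] (mod n) then of_nat n else 0)"
proof -
  note prim = primitive_root_power_eq_iff[OF n, folded \<zeta>_def]
  define w where "w = \<zeta> ^ j / \<zeta> ^ k"
  have z0: "\<zeta> \<noteq> 0" by (simp add: \<zeta>_def)
  have "(\<Sum>l<n. (\<zeta> ^ l) ^ j * inverse (\<zeta> ^ l) ^ k) = (\<Sum>l<n. w ^ l)"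
  proof (intro sum.cong refl)
    fix l
    have "(\<zeta> ^ l) ^ i = (\<zeta> ^ i) ^ l" for i
      by (simp add: mult.commute flip: power_mult)
    then show "(\<zeta> ^ l) ^ j * inverse (\<zeta> ^ l) ^ k = w ^ l"
      unfolding w_def power_divide power_inverse by (simp add: divide_inverse)
  qed
  moreover have "w = 1 \<longleftrightarrow> [j = k] (mod n)"
    unfolding w_def prim(2)[symmetric] using z0 by simp
  moreover have "w ^ n = 1"
  proof -
    have "w ^ n = (\<zeta> ^ n) ^ j / (\<zeta> ^ n) ^ k"
      unfolding w_def power_divide by (simp add: mult.commute flip: power_mult)
    then show ?thesis using prim(1) by simp
  qed
  ultimately show ?thesis by (auto simp: geometric_sum)
qed

text \<open>Integrality of the transform gives \<open>F(u)\<^sup>p \<equiv> F(u)\<close> modulo \<open>p\<close>, while the Frobenius map sends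
  \<open>F(u)\<close> to the transform of \<open>c\<^sup>p\<close> at \<open>u\<^sup>p\<close>; inverting both transforms compares \<open>c\<close> at \<open>p * m\<close> with
  \<open>c\<^sup>p\<close> at \<open>m\<close>.\<close>

lemma integral_fourier_transform_frobenius:
  fixes c :: "nat \<Rightarrow> complex"
  assumes n: "n > 0" and p: "prime p" "\<not> p dvd n"
    and c: "\<And>j. algebraic_int (c j)" and per: "\<And>j. c (j mod n) = c j"
    and int: "\<And>u. u ^ n = 1 \<Longrightarrow> (\<Sum>j<n. c j * u ^ j) \<in> \<int>"
  shows "alg_cong p (of_nat n * c (p * m)) (of_nat n * c m ^ p)"
proof -
  define \<zeta> where "\<zeta> = cis (2 * pi / real n)"
  note prim = primitive_root_power_eq_iff[OF n, folded \<zeta>_def]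
  note orth = roots_of_unity_orthogonality[OF n, folded \<zeta>_def]
  have root: "(\<zeta> ^ l) ^ n = 1" for l
  proof -
    have "(\<zeta> ^ l) ^ n = (\<zeta> ^ n) ^ l" by (simp add: mult.commute flip: power_mult)
    then show ?thesis using prim(1) by simp
  qed
  have alg: "algebraic_int u" if "u ^ n = 1" for u :: complex
    using algebraic_int_root_of_unity[OF that n] .
  have cong: "alg_cong p (\<Sum>j<n. c j * u ^ j) (\<Sum>j<n. c j ^ p * u ^ (j * p))" if u: "u ^ n = 1" for u
  proof -
    have "alg_cong p ((\<Sum>j<n. c j * u ^ j) ^ p) (\<Sum>j<n. (c j * u ^ j) ^ p)"
      using c alg[OF u] by (intro alg_cong_power_sum p algebraic_int_times algebraic_int_power) auto
    moreover have "(\<Sum>j<n. (c j * u ^ j) ^ p) = (\<Sum>j<n. c j ^ p * u ^ (j * p))"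
      by (simp add: power_mult_distrib power_mult)
    ultimately show ?thesis
      using alg_cong_trans[OF alg_cong_sym[OF alg_cong_Ints_power[OF p(1) int[OF u]]]] by simp
  qed
  \<comment> \<open>The inverse transform at \<open>p * m\<close>. The exponent \<open>g\<close>
    will be \<open>j\<close> for the original sum and \<open>j * p\<close> for its Frobenius
    image.\<close>
  have swap: "(\<Sum>l<n. inverse (\<zeta> ^ l) ^ (p * m) * (\<Sum>j<n. d j * (\<zeta> ^ l) ^ (g j))) =
      (\<Sum>j<n. d j * (if [g j = p * m] (mod n) then of_nat n else 0))" for d g
  proof -
    have "(\<Sum>l<n. inverse (\<zeta> ^ l) ^ (p * m) * (\<Sum>j<n. d j * (\<zeta> ^ l) ^ (g j))) =
        (\<Sum>l<n. \<Sum>j<n. d j * ((\<zeta> ^ l) ^ (g j) * inverse (\<zeta> ^ l) ^ (p * m)))"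
      by (simp add: sum_distrib_left mult_ac)
    also have "\<dots> = (\<Sum>j<n. d j * (\<Sum>l<n. (\<zeta> ^ l) ^ (g j) * inverse (\<zeta> ^ l) ^ (p * m)))"
      by (subst sum.swap) (simp add: sum_distrib_left)
    finally show ?thesis unfolding orth .
  qed
  have pick: "(\<Sum>j<n. d j * (if [j = k] (mod n) then of_nat n else 0)) = of_nat n * d (k mod n)"
    for d :: "nat \<Rightarrow> complex" and k
  proof -
    have "(\<Sum>j<n. d j * (if [j = k] (mod n) then of_nat n else 0)) =
        (\<Sum>j<n. if j = k mod n then of_nat n * d j else 0)"
      by (intro sum.cong refl) (auto simp: cong_def)
    then show ?thesis using n by simp
  qed
  have "alg_cong p (\<Sum>l<n. inverse (\<zeta> ^ l) ^ (p * m) * (\<Sum>j<n. c j * (\<zeta> ^ l) ^ j))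
      (\<Sum>l<n. inverse (\<zeta> ^ l) ^ (p * m) * (\<Sum>j<n. c j ^ p * (\<zeta> ^ l) ^ (j * p)))"
  proof (rule alg_cong_sum, rule alg_cong_mult[OF algebraic_int_power cong[OF root]])
    fix l
    have "inverse (\<zeta> ^ l) ^ n = 1" unfolding power_inverse root by simp
    then show "algebraic_int (inverse (\<zeta> ^ l))" by (rule alg)
  qed
  \<comment> \<open>As \<open>p\<close> is invertible modulo \<open>n\<close>, the Frobenius image
    contributes precisely the index \<open>m\<close>.\<close>
  moreover have "[j * p = p * m] (mod n) \<longleftrightarrow> [j = m] (mod n)" for j
    using cong_mult_lcancel_nat[of p n j m] prime_imp_coprime[OF p] by (simp add: mult.commute)
  ultimately show ?thesis
    unfolding swap by (simp add: pick per)
qed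

text \<open>Multiplying an equation \<open>n * d = p * r\<close> by its conjugate gives
  \<open>n ^ 2 * k = p ^ 2 * (r * cnj r)\<close>. The last factor is rational and an algebraic
  integer, hence an integer, so \<open>p\<close> would divide \<open>n ^ 2 * k\<close>.\<close>

lemma of_nat_mult_not_alg_cong_0:
  assumes p: "prime p" "\<not> p dvd n" "\<not> p dvd k" and d: "d * cnj d = of_nat k"
  shows "\<not> alg_cong p (of_nat n * d) 0"
proof
  assume "alg_cong p (of_nat n * d) 0"
  then obtain r where r: "algebraic_int r" "of_nat n * d = of_nat p * r"
    unfolding alg_cong_def by auto
  have p0: "p > 0" using p prime_gt_0_nat by blast
  have "of_nat (n ^ 2 * k) = (of_nat n * d) * cnj (of_nat n * d)"
    by (simp add: d[symmetric] power2_eq_square mult_ac)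
  also have "\<dots> = of_nat (p ^ 2) * (r * cnj r)"
    unfolding r(2) by (simp add: power2_eq_square mult_ac)
  finally have eq: "of_nat (n ^ 2 * k) = of_nat (p ^ 2) * (r * cnj r)" .
  then have "r * cnj r = of_nat (n ^ 2 * k) / of_nat (p ^ 2)"
    using p0 by (simp add: field_simps)
  also have "\<dots> \<in> \<rat>" by (intro Rats_divide) simp_all
  finally have "r * cnj r \<in> \<int>"
    using r(1) by (intro rational_algebraic_int_is_int algebraic_int_times) auto
  then obtain z where "r * cnj r = of_int z" using Ints_cases by blast
  with eq have "(of_int (int (n ^ 2 * k)) :: complex) = of_int (int (p ^ 2) * z)" by simp
  then have "int (n ^ 2 * k) = int (p ^ 2) * z" by (simp only: of_int_eq_iff)
  then have "int (p ^ 2) dvd int (n ^ 2 * k)" by simp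
  then have "p ^ 2 dvd n ^ 2 * k" by (simp only: int_dvd_int_iff)
  then have "p dvd n ^ 2 * k" by (rule dvd_trans[rotated]) (simp add: power2_eq_square)
  then show False using p by (simp add: prime_dvd_mult_iff prime_dvd_power_iff)
qed

section \<open>Arithmetic of the matrix entries\<close>

definition \<omega> :: complex where "\<omega> = (1 + \<i> * complex_of_real (sqrt 3)) / 2"

lemma cnj_omega: "cnj \<omega> = (1 - \<i> * complex_of_real (sqrt 3)) / 2"
  by (simp add: \<omega>_def)

lemma omega_square: "\<omega> ^ 2 = \<omega> - 1"
  by (simp add: \<omega>_def complex_eq_iff power2_eq_square)

lemma omega_plus_cnj: "cnj \<omega> = 1 - \<omega>"
  unfolding cnj_omega by (simp add: \<omega>_def field_simps)

text \<open>As rewrite rules these reduce every polynomial in \<omega> to a combination of 1 and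
  \<omega>; the second form also fires inside right-nested products.\<close>

lemma omega_mult_omega: "\<omega> * \<omega> = \<omega> - 1" "\<omega> * (\<omega> * z) = \<omega> * z - z"
proof -
  show "\<omega> * \<omega> = \<omega> - 1" using omega_square by (simp add: power2_eq_square)
  then show "\<omega> * (\<omega> * z) = \<omega> * z - z" by (simp add: left_diff_distrib flip: mult.assoc)
qed

lemma omega_cube: "\<omega> ^ 3 = - 1"
  by (simp add: power3_eq_cube omega_mult_omega left_diff_distrib)

lemma omega_neq [simp]: "\<omega> \<noteq> 0" "\<omega> \<noteq> 1" "cnj \<omega> \<noteq> \<omega>" "cnj \<omega> \<noteq> 1"
  by (auto simp: \<omega>_def complex_eq_iff)

lemma omega_sixth_power: "\<omega> ^ 6 = 1"
proof -
  have "\<omega> ^ 6 = (\<omega> ^ 3) ^ 2" by (simp flip: power_mult)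
  then show ?thesis by (simp add: omega_cube)
qed

lemma algebraic_int_omega: "algebraic_int \<omega>"
  by (rule algebraic_int_root_of_unity[OF omega_sixth_power]) simp

text \<open>The power depends on \<open>k mod 6\<close>, which parity and the residue modulo 3
  determine: it is 1 in the first case and 5, that is -1, in the second.\<close>

lemma omega_power_odd:
  assumes "odd k"
  shows "[k = 1] (mod 3) \<Longrightarrow> \<omega> ^ k = \<omega>" and "[k = 2] (mod 3) \<Longrightarrow> \<omega> ^ k = cnj \<omega>"
proof -
  have "\<omega> ^ k = \<omega> ^ (6 * (k div 6) + k mod 6)" by simp
  also have "\<dots> = \<omega> ^ (k mod 6)" unfolding power_add power_mult omega_sixth_power by simp
  finally have red: "\<omega> ^ k = \<omega> ^ (k mod 6)" .
  have "k mod 6 \<in> {0, 1, 2, 3, 4, 5}" using mod_less_divisor[of 6 k] by auto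
  moreover have "k mod 6 mod 3 = k mod 3" "k mod 6 mod 2 = 1"
    using assms by (simp_all add: mod_mod_cancel odd_iff_mod_2_eq_one)
  ultimately have mod6: "k mod 6 = 1 \<and> k mod 3 = 1 \<or> k mod 6 = 5 \<and> k mod 3 = 2 \<or> k mod 6 = 3 \<and> k mod 3 = 0"
    by auto
  show "\<omega> ^ k = \<omega>" if "[k = 1] (mod 3)"
  proof -
    have "k mod 6 = 1" using mod6 that by (auto simp: cong_def)
    then show ?thesis using red by simp
  qed
  show "\<omega> ^ k = cnj \<omega>" if "[k = 2] (mod 3)"
  proof -
    have "k mod 6 = 5" using mod6 that by (auto simp: cong_def)
    moreover have "\<omega> ^ 5 = \<omega> ^ 3 * \<omega> ^ 2" by (simp flip: power_add)
    ultimately show ?thesis using red by (simp add: omega_cube omega_square omega_plus_cnj)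
  qed
qed

definition hermitian2_values :: "complex set" where
  "hermitian2_values = {0, 1, \<omega>, cnj \<omega>}"

lemma coprime_imp_not_dvd:
  fixes d k m :: nat
  assumes "coprime k m" "d dvd m" "d \<noteq> 1"
  shows "\<not> d dvd k"
  using coprime_common_divisor[OF assms(1) _ assms(2)] assms(3) by (simp only: nat_dvd_1_iff_1) blast

text \<open>An exponent prime to 6 is 1 or -1 modulo 6, so taking the power either fixes the four
  values or conjugates them.\<close>

lemma hermitian2_values_power:
  assumes "coprime k 6" "x \<in> hermitian2_values"
  shows "x ^ k \<in> hermitian2_values"
proof -
  have odd: "odd k" and 3: "\<not> 3 dvd k"
    using coprime_imp_not_dvd[OF assms(1)] by simp_all
  have "[k = 1] (mod 3) \<or> [k = 2] (mod 3)" using 3 mod_less_divisor[of 3 k]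
    unfolding cong_def dvd_eq_mod_eq_0 by (simp del: mod_less_divisor) linarith
  then have "\<omega> ^ k = \<omega> \<or> \<omega> ^ k = cnj \<omega>" using omega_power_odd(1)[OF odd] omega_power_odd(2)[OF odd] by blast
  moreover have "cnj \<omega> ^ k = cnj (\<omega> ^ k)" by simp
  ultimately have "\<omega> ^ k \<in> {\<omega>, cnj \<omega>}" "cnj \<omega> ^ k \<in> {\<omega>, cnj \<omega>}"
    by (elim disjE; simp)+
  moreover have "(0 :: complex) ^ k = 0" using odd by (cases k) simp_all
  ultimately show ?thesis using assms(2) unfolding hermitian2_values_def by auto
qed

text \<open>The four values are the vertices of two unit equilateral triangles sharing the side from
  0 to 1. All distances are 1, except the distance between \<omega> and \<open>cnj \<omega>\<close>,
  whose square is 3. Hence a prime not dividing 6 separates the values.\<close>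

lemma hermitian2_values_diff:
  assumes "x \<in> hermitian2_values" "y \<in> hermitian2_values" "x \<noteq> y"
  shows "\<exists>k\<in>{1, 3}. (x - y) * cnj (x - y) = of_nat k"
proof -
  have c: "cnj \<omega> = 1 - \<omega>" "cnj (x - y) = cnj x - cnj y" by (simp_all add: omega_plus_cnj)
  have "(x - y) * (cnj x - cnj y) \<in> {1, 3}"
    using assms unfolding hermitian2_values_def c(1)
    by (elim insertE emptyE; hypsubst; simp add: omega_plus_cnj algebra_simps omega_mult_omega)
  then show ?thesis unfolding c(2) by auto
qed

lemma alg_cong_hermitian2_values_eq:
  assumes "prime p" "\<not> p dvd n" "\<not> p dvd 6"
    and xy: "x \<in> hermitian2_values" "y \<in> hermitian2_values"
    and "alg_cong p (of_nat n * x) (of_nat n * y)"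
  shows "x = y"
proof (rule ccontr)
  assume "x \<noteq> y"
  then obtain k where k: "k \<in> {1, 3}" "(x - y) * cnj (x - y) = of_nat k"
    using hermitian2_values_diff[OF xy] by blast
  have "\<not> p dvd k"
    using k(1) assms(1,3) by (auto dest: dvd_trans[of p 3 6])
  moreover have "alg_cong p (of_nat n * (x - y)) 0"
    using assms(6) unfolding alg_cong_def by (simp add: right_diff_distrib)
  ultimately show False
    using of_nat_mult_not_alg_cong_0[OF assms(1,2) _ k(2)] by blast
qed

lemma coprime_representative_coprime_6:
  fixes k n :: nat
  assumes kn: "coprime k n"
  obtains k' where "[k' = k] (mod n)" "coprime k' (6 * n)"
proof
  \<comment> \<open>For each of the primes 2 and 3, \<open>t\<close> is divisible by the prime
    exactly when \<open>k\<close> is not. So the prime divides exactly one of \<open>k\<close> and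
    \<open>n * t\<close>; when it divides \<open>k\<close>, coprimality keeps it from dividing
    \<open>n\<close>.\<close>
  define t where "t = (if even k then 1 else 2) * (if 3 dvd k then 1 else (3 :: nat))"
  have 2: "odd (k + n * t)"
  proof (cases "even k")
    case True
    then have "odd n" using coprime_imp_not_dvd[of n k 2] kn by (simp add: coprime_commute)
    then show ?thesis using True by (simp add: t_def)
  next
    case False
    then show ?thesis by (simp add: t_def)
  qed
  have 3: "\<not> 3 dvd k + n * t"
  proof (cases "3 dvd k")
    case True
    have "\<not> 3 dvd n" using coprime_imp_not_dvd[of n k 3] kn True by (simp add: coprime_commute)
    moreover have "\<not> 3 dvd t" using True by (simp add: t_def)
    ultimately have "\<not> 3 dvd n * t" by (simp add: prime_dvd_mult_iff)
    then show ?thesis using True by (simp add: dvd_add_right_iff)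
  next
    case False
    then have "3 dvd n * t" by (simp add: t_def)
    then show ?thesis using False by (simp add: dvd_add_left_iff)
  qed
  show "[k + n * t = k] (mod n)" by (simp add: cong_def)
  have "coprime (k + n * t) 2" using 2 by (simp add: coprime_right_2_iff_odd)
  moreover have "coprime (k + n * t) 3"
    using 3 by (simp add: coprime_commute prime_imp_coprime)
  ultimately have "coprime (k + n * t) (2 * 3)" by (simp only: coprime_mult_right_iff)
  moreover have "coprime (k + n * t) n"
    using kn by (metis coprime_iff_gcd_eq_1 gcd.commute gcd_add_mult mult.commute add.commute)
  ultimately show "coprime (k + n * t) (6 * n)" by simp
qed

text \<open>The coordinates of an eigenvector together with their multiples by \<omega> span a group
  stable under the entries of \<open>A\<close>, since \<omega> satisfies a monic quadratic equation.
  The rows of the eigenvector equation make it stable under \<open>l\<close>.\<close>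

lemma algebraic_int_eigenvalue_hermitian2_values:
  fixes A :: "complex mat"
  assumes A: "A \<in> carrier_mat n n" and l: "eigenvalue A l"
    and entries: "\<And>i j. i < n \<Longrightarrow> j < n \<Longrightarrow> A $$ (i, j) \<in> hermitian2_values"
  shows "algebraic_int l"
proof -
  obtain v where v: "v \<in> carrier_vec n" "v \<noteq> 0\<^sub>v n" and ev: "A *\<^sub>v v = l \<cdot>\<^sub>v v"
    using l A unfolding eigenvalue_def eigenvector_def by auto
  define V where "V = (\<lambda>i. v $ i) ` {..<n} \<union> (\<lambda>i. \<omega> * v $ i) ` {..<n}"
  have fin: "finite V" unfolding V_def by simp
  have row: "l * v $ i = (\<Sum>j<n. A $$ (i, j) * v $ j)" if "i < n" for i
  proof -
    have "l * v $ i = (A *\<^sub>v v) $ i" using that v ev by simp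
    then show ?thesis using that v A by (simp add: scalar_prod_def atLeast0LessThan)
  qed
  have base: "v $ j \<in> int_span V" "\<omega> * v $ j \<in> int_span V" if "j < n" for j
    using that fin by (auto simp: V_def intro!: int_span_base)
  have diff: "x - y \<in> int_span V" if "x \<in> int_span V" "y \<in> int_span V" for x y
    using int_span_add[OF that(1) int_span_mult_int[OF that(2), of "- 1"]] by simp
  have entry: "a * v $ j \<in> int_span V" "a * (\<omega> * v $ j) \<in> int_span V"
    if a: "a \<in> hermitian2_values" and j: "j < n" for a j
  proof -
    note b = base[OF j] diff[OF base[OF j]] diff[OF base(2)[OF j] base(1)[OF j]]
    show "a * v $ j \<in> int_span V" "a * (\<omega> * v $ j) \<in> int_span V"
      using a b unfolding hermitian2_values_def
      by (auto simp: omega_plus_cnj left_diff_distrib omega_mult_omega)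
  qed
  obtain i where i: "i < n" "v $ i \<noteq> 0"
    using v by (metis carrier_vecD eq_vecI index_zero_vec)
  show ?thesis
  proof (rule algebraic_int_if_stable[OF fin])
    show "v $ i \<in> V" "v $ i \<noteq> 0" using i by (auto simp: V_def)
    fix w assume "w \<in> V"
    then consider j where "j < n" "w = v $ j" | j where "j < n" "w = \<omega> * v $ j"
      unfolding V_def by auto
    then show "l * w \<in> int_span V"
    proof cases
      case 1
      then show ?thesis using row entries entry(1) by (auto intro!: int_span_sum)
    next
      case 2
      have "l * w = \<omega> * (l * v $ j)" using 2 by simp
      also have "\<dots> = (\<Sum>k<n. A $$ (j, k) * (\<omega> * v $ k))"
        unfolding row[OF 2(1)] by (simp add: sum_distrib_left mult_ac)
      also have "\<dots> \<in> int_span V" using 2 entries entry(2) by (intro int_span_sum) auto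
      finally show ?thesis .
    qed
  qed
qed

subsection \<open>Convolution matrices\<close>

context group
begin

lemma inv_mult_cancel [simp]:
  assumes "a \<in> carrier G" "b \<in> carrier G"
  shows "inv a \<otimes> (a \<otimes> b) = b" "a \<otimes> (inv a \<otimes> b) = b"
  using assms by (simp_all flip: m_assoc)

context
  fixes vs :: "'a list"
  assumes distinct_vs: "distinct vs" and set_vs: "set vs = carrier G"
begin

lemma finite_carrier: "finite (carrier G)"
  using set_vs by (metis List.finite_set)

definition conv_mat :: "('a \<Rightarrow> complex) \<Rightarrow> complex mat" where
  "conv_mat h = mat (length vs) (length vs) (\<lambda>(i, j). h (vs ! j \<otimes> inv (vs ! i)))"

lemma conv_mat_carrier [simp]: "conv_mat h \<in> carrier_mat (length vs) (length vs)"
  by (simp add: conv_mat_def)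

lemma vs_in_carrier [simp]: "i < length vs \<Longrightarrow> vs ! i \<in> carrier G"
  using set_vs nth_mem by blast

lemma conv_mat_cong: "(\<And>z. z \<in> carrier G \<Longrightarrow> h z = g z) \<Longrightarrow> conv_mat h = conv_mat g"
  by (auto simp: conv_mat_def intro!: eq_matI)

lemma conv_mat_add: "conv_mat (\<lambda>z. h z + g z) = conv_mat h + conv_mat g"
  by (auto simp: conv_mat_def intro!: eq_matI)

lemma conv_mat_smult: "conv_mat (\<lambda>z. c * h z) = c \<cdot>\<^sub>m conv_mat h"
  by (auto simp: conv_mat_def intro!: eq_matI)

lemma sum_nth_vs: "(\<Sum>k<length vs. q (vs ! k)) = (\<Sum>u\<in>carrier G. q u)"
proof -
  have "inj_on ((!) vs) {..<length vs}" using distinct_vs by (simp add: inj_on_nth)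
  moreover have "(!) vs ` {..<length vs} = carrier G"
    unfolding set_vs[symmetric] by (auto simp: set_conv_nth)
  ultimately show ?thesis by (metis (no_types, lifting) comp_apply sum.cong sum.reindex)
qed

lemma length_vs: "length vs = card (carrier G)"
  unfolding set_vs[symmetric] using distinct_card[OF distinct_vs] by simp

definition conv :: "('a \<Rightarrow> complex) \<Rightarrow> ('a \<Rightarrow> complex) \<Rightarrow> 'a \<Rightarrow> complex" where
  "conv h g z = (\<Sum>w\<in>carrier G. h w * g (z \<otimes> inv w))"

lemma conv_mat_mult: "conv_mat h * conv_mat g = conv_mat (conv h g)"
proof (rule eq_matI)
  fix i j assume "i < dim_row (conv_mat (conv h g))" "j < dim_col (conv_mat (conv h g))"
  then have ij: "i < length vs" "j < length vs" by (auto simp: conv_mat_def)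
  let ?a = "vs ! i" and ?b = "vs ! j"
  have ab: "?a \<in> carrier G" "?b \<in> carrier G" using ij by auto
  have "(conv_mat h * conv_mat g) $$ (i, j) =
      (\<Sum>k<length vs. h (vs ! k \<otimes> inv ?a) * g (?b \<otimes> inv (vs ! k)))"
    using ij by (subst index_mult_mat_sum[of _ "length vs"]) (auto simp: conv_mat_def)
  also have "\<dots> = (\<Sum>u\<in>carrier G. h (u \<otimes> inv ?a) * g (?b \<otimes> inv u))"
    by (rule sum_nth_vs)
  also have "\<dots> = (\<Sum>w\<in>carrier G. h w * g (?b \<otimes> inv ?a \<otimes> inv w))"
    using ab by (intro sum.reindex_bij_witness[of _ "\<lambda>w. w \<otimes> ?a" "\<lambda>u. u \<otimes> inv ?a"])
      (auto simp: m_assoc inv_mult_group)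
  also have "\<dots> = conv_mat (conv h g) $$ (i, j)"
    using ij by (simp add: conv_mat_def conv_def)
  finally show "(conv_mat h * conv_mat g) $$ (i, j) = conv_mat (conv h g) $$ (i, j)" .
qed (auto simp: conv_mat_def)

text \<open>Both convolutions become sums over \<open>u\<close> of \<open>g u\<close> times a value
  of \<open>f\<close>, at \<open>inv u \<otimes> z\<close> and at \<open>z \<otimes> inv u\<close>.
  These arguments are conjugate by \<open>u\<close>.\<close>

lemma conv_mat_class_function_commute:
  assumes f: "\<And>a z. a \<in> carrier G \<Longrightarrow> z \<in> carrier G \<Longrightarrow> f (a \<otimes> z \<otimes> inv a) = f z"
  shows "conv_mat f * conv_mat g = conv_mat g * conv_mat f"
  unfolding conv_mat_mult
proof (rule conv_mat_cong)
  fix z assume z: "z \<in> carrier G"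
  have "conv f g z = (\<Sum>u\<in>carrier G. f (inv u \<otimes> z) * g u)"
    unfolding conv_def using z
    by (intro sum.reindex_bij_witness[of _ "\<lambda>u. inv u \<otimes> z" "\<lambda>w. z \<otimes> inv w"])
      (auto simp: m_assoc inv_mult_group)
  also have "\<dots> = conv g f z"
    unfolding conv_def
  proof (rule sum.cong[OF refl])
    fix u assume u: "u \<in> carrier G"
    have "f (inv u \<otimes> z) = f (u \<otimes> (inv u \<otimes> z) \<otimes> inv u)"
      using f[of u "inv u \<otimes> z"] u z by simp
    also have "u \<otimes> (inv u \<otimes> z) \<otimes> inv u = z \<otimes> inv u"
      using u z by (simp flip: m_assoc)
    finally show "f (inv u \<otimes> z) * g u = g u * f (z \<otimes> inv u)" by simp
  qed
  finally show "conv f g z = conv g f z" .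
qed

lemma mat_tr_conv_mat: "mat_tr (conv_mat h) = of_nat (card (carrier G)) * h \<one>"
  by (simp add: mat_tr_def conv_mat_def length_vs[symmetric])

definition extend0 :: "'a set \<Rightarrow> ('a \<Rightarrow> complex) \<Rightarrow> 'a \<Rightarrow> complex" where
  "extend0 H \<theta> z = (if z \<in> H then \<theta> z else 0)"

text \<open>For \<open>z\<close> in \<open>H\<close>, each \<open>w\<close> in \<open>H\<close>
  contributes \<open>\<theta> w * \<theta> (z \<otimes> inv w)\<close>, which is
  \<open>\<theta> z\<close>; for \<open>z\<close> outside \<open>H\<close> all contributions
  vanish.\<close>

lemma conv_mat_character_quasi_idempotent:
  assumes H: "subgroup H G"
    and \<theta>: "\<And>a b. a \<in> H \<Longrightarrow> b \<in> H \<Longrightarrow> \<theta> (a \<otimes> b) = \<theta> a * \<theta> b"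
  shows "conv_mat (extend0 H \<theta>) * conv_mat (extend0 H \<theta>) =
    of_int (int (card H)) \<cdot>\<^sub>m conv_mat (extend0 H \<theta>)"
  unfolding conv_mat_mult conv_mat_smult[symmetric]
proof (rule conv_mat_cong)
  fix z assume z: "z \<in> carrier G"
  note HG = subgroup.mem_carrier[OF H]
  have HH: "H \<subseteq> carrier G" using HG by blast
  have shift: "extend0 H \<theta> (z \<otimes> inv w) = (if z \<in> H then \<theta> (z \<otimes> inv w) else 0)" if w: "w \<in> H" for w
  proof -
    have "z = z \<otimes> inv w \<otimes> w" using z HG[OF w] by (simp add: m_assoc)
    then have "z \<otimes> inv w \<in> H \<longleftrightarrow> z \<in> H"
      using w subgroup.m_closed[OF H] subgroup.m_inv_closed[OF H] by metis
    then show ?thesis by (simp add: extend0_def)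
  qed
  have "conv (extend0 H \<theta>) (extend0 H \<theta>) z = (\<Sum>w\<in>H. \<theta> w * extend0 H \<theta> (z \<otimes> inv w))"
    unfolding conv_def using HH finite_carrier
    by (intro sum.mono_neutral_cong_right) (auto simp: extend0_def)
  also have "\<dots> = (\<Sum>w\<in>H. extend0 H \<theta> z)"
  proof (rule sum.cong[OF refl])
    fix w assume w: "w \<in> H"
    show "\<theta> w * extend0 H \<theta> (z \<otimes> inv w) = extend0 H \<theta> z"
    proof (cases "z \<in> H")
      case True
      have "\<theta> (z \<otimes> inv w) * \<theta> w = \<theta> (z \<otimes> inv w \<otimes> w)"
        using True w H by (intro \<theta>[symmetric]) (auto intro: subgroup.m_closed subgroup.m_inv_closed)
      also have "z \<otimes> inv w \<otimes> w = z" using z HG[OF w] by (simp add: m_assoc)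
      finally show ?thesis unfolding shift[OF w] using True by (simp add: extend0_def mult.commute)
    qed (use shift[OF w] in \<open>simp add: extend0_def\<close>)
  qed
  finally show "conv (extend0 H \<theta>) (extend0 H \<theta>) z = of_int (int (card H)) * extend0 H \<theta> z"
    by simp
qed

section \<open>Cyclic subgroups, their characters and Fourier coefficients\<close>

lemma pow_mod_ord:
  assumes "x \<in> carrier G"
  shows "x [^] (j mod ord x) = x [^] (j :: nat)"
proof -
  have "x [^] j = x [^] (ord x * (j div ord x) + j mod ord x)" by simp
  also have "\<dots> = (x [^] ord x) [^] (j div ord x) \<otimes> x [^] (j mod ord x)"
    using assms by (simp only: nat_pow_mult[symmetric] nat_pow_pow)
  finally show ?thesis using assms by simp
qed

lemma pow_eq_pow_iff_cong:
  assumes "x \<in> carrier G"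
  shows "x [^] (i :: nat) = x [^] (j :: nat) \<longleftrightarrow> [i = j] (mod ord x)"
proof -
  have "x [^] i = x [^] j \<longleftrightarrow> x [^] int i = x [^] int j" by (simp add: int_pow_int)
  also have "\<dots> \<longleftrightarrow> [int j = int i] (mod int (ord x))"
    using int_pow_eq[OF assms] by (simp add: cong_iff_dvd_diff)
  finally show ?thesis by (simp add: cong_int_iff cong_sym_eq)
qed

lemma ord_pos: "x \<in> carrier G \<Longrightarrow> ord x > 0"
  using ord_ge_1[OF finite_carrier] by force

lemma generate_eq_pow: "x \<in> carrier G \<Longrightarrow> generate G {x} = (\<lambda>j. x [^] j) ` {..<ord x}"
proof -
  assume x: "x \<in> carrier G"
  have "generate G {x} = {x [^] k | k. k \<in> (UNIV :: nat set)}"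
    by (rule generate_pow_on_finite_carrier[OF finite_carrier x])
  also have "\<dots> = (\<lambda>j. x [^] j) ` {..<ord x}"
  proof (intro equalityI subsetI)
    fix y assume "y \<in> {x [^] k | k. k \<in> (UNIV :: nat set)}"
    then obtain k :: nat where "y = x [^] k" by blast
    then have "y = x [^] (k mod ord x)" using pow_mod_ord[OF x] by simp
    then show "y \<in> (\<lambda>j. x [^] j) ` {..<ord x}" using ord_pos[OF x] by auto
  qed auto
  finally show ?thesis .
qed

lemma inj_on_pow: "x \<in> carrier G \<Longrightarrow> inj_on (\<lambda>j. x [^] (j :: nat)) {..<ord x}"
  by (auto simp: inj_on_def pow_eq_pow_iff_cong cong_def)

lemma generate_subgroup: "x \<in> carrier G \<Longrightarrow> subgroup (generate G {x}) G"
  by (intro generate_is_subgroup) simp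

text \<open>The exponent is picked by choice; it is determined modulo \<open>ord x\<close>, which
  suffices because \<open>u ^ ord x = 1\<close>.\<close>

lemma cyclic_character_exists:
  fixes u :: complex
  assumes x: "x \<in> carrier G" and u: "u ^ ord x = 1"
  obtains \<theta> where "\<And>j :: nat. \<theta> (x [^] j) = u ^ j"
    "\<And>a b. a \<in> generate G {x} \<Longrightarrow> b \<in> generate G {x} \<Longrightarrow> \<theta> (a \<otimes> b) = \<theta> a * \<theta> b"
proof -
  define \<theta> where "\<theta> z = u ^ (SOME j :: nat. z = x [^] j)" for z
  have upow: "u ^ j = u ^ (j mod ord x)" for j
  proof -
    have "u ^ j = u ^ (ord x * (j div ord x) + j mod ord x)" by simp
    also have "\<dots> = u ^ (j mod ord x)" unfolding power_add power_mult u by simp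
    finally show ?thesis .
  qed
  have 1: "\<theta> (x [^] j) = u ^ j" for j :: nat
  proof -
    have "x [^] j = x [^] (SOME i :: nat. x [^] j = x [^] i)"
      by (rule someI[of "\<lambda>i. x [^] j = x [^] i" j]) simp
    then have "[j = (SOME i :: nat. x [^] j = x [^] i)] (mod ord x)"
      using pow_eq_pow_iff_cong[OF x] by blast
    then show ?thesis unfolding \<theta>_def cong_def using upow by metis
  qed
  have 2: "\<theta> (a \<otimes> b) = \<theta> a * \<theta> b" if ab: "a \<in> generate G {x}" "b \<in> generate G {x}" for a b
  proof -
    obtain i j :: nat where "a = x [^] i" "b = x [^] j"
      using ab generate_eq_pow[OF x] by auto
    then show ?thesis using x by (simp add: nat_pow_mult 1 power_add)
  qed
  from that[OF 1 2] show thesis .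
qed

text \<open>The sum times the group order is the trace of \<open>conv_mat f\<close> multiplied by a
  character matrix, hence an integer. The sum is therefore rational, and it is an algebraic
  integer.\<close>

lemma fourier_coefficient_integral:
  assumes f: "\<And>a z. a \<in> carrier G \<Longrightarrow> z \<in> carrier G \<Longrightarrow> f (a \<otimes> z \<otimes> inv a) = f z"
    and alg: "\<And>z. z \<in> carrier G \<Longrightarrow> algebraic_int (f z)"
    and ev: "\<And>e. eigenvalue (conv_mat f) e \<Longrightarrow> e \<in> \<int>"
    and x: "x \<in> carrier G" and u: "u ^ ord x = 1"
  shows "(\<Sum>j<ord x. f (x [^] j) * u ^ j) \<in> \<int>"
proof -
  let ?F = "\<Sum>j<ord x. f (x [^] j) * u ^ j"
  \<comment> \<open>Convolution at the identity pairs \<open>f w\<close> with the character at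
    \<open>inv w\<close>. Prescribing the value \<open>u\<close> at \<open>inv x\<close> therefore
    makes \<open>u ^ j\<close> the coefficient of \<open>f (x [^] j)\<close>.\<close>
  have ix: "inv x \<in> carrier G" and io: "ord (inv x) = ord x" using x by simp_all
  obtain \<theta> where \<theta>: "\<And>j :: nat. \<theta> (inv x [^] j) = u ^ j"
    "\<And>a b. a \<in> generate G {inv x} \<Longrightarrow> b \<in> generate G {inv x} \<Longrightarrow> \<theta> (a \<otimes> b) = \<theta> a * \<theta> b"
    using cyclic_character_exists[OF ix, of u] u io by auto
  let ?H = "generate G {inv x}"
  let ?e = "extend0 ?H \<theta>"
  have H: "subgroup ?H G" by (rule generate_subgroup[OF ix])
  have "mat_tr (conv_mat f * conv_mat ?e) \<in> \<int>"
    by (rule mat_tr_commuting_quasi_idempotent[OF _ _ ev conv_mat_class_function_commute[OF f]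
          conv_mat_character_quasi_idempotent[OF H \<theta>(2)]]) (rule conv_mat_carrier)+
  moreover have "conv f ?e \<one> = ?F"
  proof -
    have "conv f ?e \<one> = (\<Sum>w\<in>carrier G. f w * ?e (inv w))"
      unfolding conv_def by (intro sum.cong) auto
    also have "\<dots> = (\<Sum>w\<in>carrier G. f (inv w) * ?e w)"
      by (intro sum.reindex_bij_witness[of _ "m_inv G" "m_inv G"]) auto
    also have "\<dots> = (\<Sum>w\<in>?H. f (inv w) * \<theta> w)"
      using subgroup.subset[OF H] finite_carrier
      by (intro sum.mono_neutral_cong_right) (auto simp: extend0_def)
    also have "\<dots> = (\<Sum>j<ord x. f (inv (inv x [^] j)) * \<theta> (inv x [^] j))"
      unfolding generate_eq_pow[OF ix] sum.reindex[OF inj_on_pow[OF ix]] by (simp add: io)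
    also have "\<dots> = ?F"
    proof (intro sum.cong refl)
      fix j :: nat
      have "inv (inv x [^] j) = x [^] j" using nat_pow_inv[OF x, of j] x by simp
      then show "f (inv (inv x [^] j)) * \<theta> (inv x [^] j) = f (x [^] j) * u ^ j"
        by (simp add: \<theta>(1))
    qed
    finally show ?thesis .
  qed
  ultimately have NF: "of_nat (card (carrier G)) * ?F \<in> \<int>"
    unfolding conv_mat_mult mat_tr_conv_mat by simp
  have N: "of_nat (card (carrier G)) \<noteq> (0 :: complex)" using one_closed finite_carrier by auto
  have "?F = of_nat (card (carrier G)) * ?F / of_nat (card (carrier G))" using N by simp
  also have "\<dots> \<in> \<rat>" using NF Ints_subset_Rats by (intro Rats_divide) auto
  finally have "?F \<in> \<rat>" .
  moreover have "algebraic_int ?F"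
    using alg x algebraic_int_root_of_unity[OF u ord_pos[OF x]]
    by (intro algebraic_int_sum algebraic_int_times algebraic_int_power) auto
  ultimately show ?thesis by (rule rational_algebraic_int_is_int[rotated])
qed

text \<open>The Frobenius comparison at \<open>m = 1\<close> gives a congruence modulo
  \<open>p\<close> between two admissible values, and such a congruence is an equality.\<close>

lemma integral_spectrum_power_prime:
  assumes f: "\<And>a z. a \<in> carrier G \<Longrightarrow> z \<in> carrier G \<Longrightarrow> f (a \<otimes> z \<otimes> inv a) = f z"
    and val: "\<And>z. f z \<in> hermitian2_values"
    and ev: "\<And>e. eigenvalue (conv_mat f) e \<Longrightarrow> e \<in> \<int>"
    and x: "x \<in> carrier G" and p: "prime p" "coprime p (6 * ord x)"
  shows "f (x [^] p) = f x ^ p"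
proof -
  have alg: "algebraic_int (f z)" for z
    using val[of z] algebraic_int_omega unfolding hermitian2_values_def
    by (auto intro: int_imp_algebraic_int)
  have "coprime (6 * ord x) p" using p(2) by (simp only: coprime_commute)
  then have "\<not> p dvd 6 * ord x"
    using p(1) by (intro coprime_imp_not_dvd) auto
  then have ndvd: "\<not> p dvd ord x" "\<not> p dvd 6"
    using dvd_mult[of p "ord x" 6] dvd_mult2[of p 6 "ord x"] by blast+
  have "alg_cong p (of_nat (ord x) * f (x [^] (p * 1))) (of_nat (ord x) * f (x [^] (1 :: nat)) ^ p)"
    by (rule integral_fourier_transform_frobenius[OF ord_pos[OF x] p(1) ndvd(1),
          where c = "\<lambda>j. f (x [^] j)"])
      (use alg pow_mod_ord[OF x] fourier_coefficient_integral[OF f alg ev x] in auto)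
  then have "alg_cong p (of_nat (ord x) * f (x [^] p)) (of_nat (ord x) * f x ^ p)"
    using x by simp
  moreover have "coprime p 6" using p(2) by simp
  ultimately show ?thesis
    using alg_cong_hermitian2_values_eq[OF p(1) ndvd] val hermitian2_values_power by blast
qed

text \<open>Prime factors of \<open>k\<close> are split off one at a time. The element
  \<open>x [^] k'\<close> has the order of \<open>x\<close>, so the prime case applies to
  it.\<close>

lemma integral_spectrum_power:
  assumes f: "\<And>a z. a \<in> carrier G \<Longrightarrow> z \<in> carrier G \<Longrightarrow> f (a \<otimes> z \<otimes> inv a) = f z"
    and val: "\<And>z. f z \<in> hermitian2_values"
    and ev: "\<And>e. eigenvalue (conv_mat f) e \<Longrightarrow> e \<in> \<int>"
    and x: "x \<in> carrier G" and k: "coprime k (6 * ord x)"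
  shows "f (x [^] k) = f x ^ k"
  using k
proof (induction k rule: less_induct)
  case (less k)
  consider "k = 0" | "k = 1" | "k > 1" by linarith
  then show ?case
  proof cases
    case 1
    \<comment> \<open>Zero is not coprime to \<open>6 * ord x\<close>, which is never 1.\<close>
    then show ?thesis using less.prems by simp
  next
    case 2
    then show ?thesis using x by simp
  next
    case 3
    then obtain p where p: "prime p" "p dvd k" using prime_factor_nat[of k] by auto
    then obtain k' where k': "k = p * k'" by blast
    then have cop: "coprime p (6 * ord x)" "coprime k' (6 * ord x)" using less.prems by auto
    have "k' < k" using k' 3 prime_gt_1_nat[OF p(1)] by (cases "k' = 0") auto
    then have IH: "f (x [^] k') = f x ^ k'" using less.IH cop by blast
    have "ord (x [^] k') = ord x"
      using pow_ord_eq_ord_iff[OF finite_carrier x] cop(2) by simp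
    then have "f ((x [^] k') [^] p) = f (x [^] k') ^ p"
      using integral_spectrum_power_prime[OF f val ev _ p(1), of "x [^] k'"] x cop by simp
    then show ?thesis using x IH k' by (simp add: nat_pow_pow mult.commute flip: power_mult)
  qed
qed

subsection \<open>Generators of cyclic subgroups\<close>

text \<open>These classes turn out to be the atoms of the Boolean algebra generated by the
  subgroups.\<close>

definition gens :: "'a \<Rightarrow> 'a set" where
  "gens x = {y \<in> carrier G. generate G {y} = generate G {x}}"

lemma gens_self: "x \<in> carrier G \<Longrightarrow> x \<in> gens x"
  by (simp add: gens_def)

lemma in_generate_self: "x \<in> carrier G \<Longrightarrow> x \<in> generate G {x}"
  by (simp add: generate.incl)

lemma generate_mono1:
  assumes "x \<in> carrier G" "y \<in> generate G {x}"
  shows "generate G {y} \<subseteq> generate G {x}"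
  using generate_subgroup_incl[OF _ generate_subgroup[OF assms(1)], of "{y}"] assms(2) by simp

lemma generate_subset_carrier: "x \<in> carrier G \<Longrightarrow> generate G {x} \<subseteq> carrier G"
  using subgroup.subset[OF generate_subgroup] .

lemma gens_subset_generate: "gens x \<subseteq> generate G {x}"
  unfolding gens_def using in_generate_self by blast

lemma generator_is_coprime_power:
  assumes x: "x \<in> carrier G" and y: "y \<in> gens x"
  obtains k :: nat where "y = x [^] k" "coprime k (ord x)"
proof -
  have yc: "y \<in> carrier G" and gen: "generate G {y} = generate G {x}"
    using y by (auto simp: gens_def)
  obtain k :: nat where k: "y = x [^] k"
    using gens_subset_generate y generate_eq_pow[OF x] by blast
  have "ord (x [^] k) = ord x"
    using generate_pow_card[OF x] generate_pow_card[OF yc] gen k by simp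
  then show thesis using that k pow_ord_eq_ord_iff[OF finite_carrier x] by blast
qed

lemma inv_in_gens: "x \<in> carrier G \<Longrightarrow> inv x \<in> gens x"
proof -
  assume x: "x \<in> carrier G"
  have sub: "generate G {inv y} \<subseteq> generate G {y}" if "y \<in> carrier G" for y
    using generate_mono1[OF that subgroup.m_inv_closed[OF generate_subgroup[OF that] in_generate_self[OF that]]] .
  have "generate G {inv x} = generate G {x}"
    using sub[OF x] sub[of "inv x"] x by (simp add: subset_antisym)
  then show ?thesis using x by (simp add: gens_def)
qed

lemma gens_eq: "y \<in> gens x \<Longrightarrow> gens y = gens x"
  by (auto simp: gens_def)

definition gens_closed :: "'a set \<Rightarrow> bool" where
  "gens_closed U \<longleftrightarrow> U \<subseteq> carrier G \<and> (\<forall>x\<in>U. gens x \<subseteq> U)"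

lemma boolean_algebra_empty: "{} \<in> boolean_algebra_subgroups G"
  using boolean_algebra_subgroups.complement[OF boolean_algebra_subgroups.subgroup[OF subgroup_self]]
  by simp

lemma boolean_algebra_Union:
  "finite I \<Longrightarrow> (\<And>i. i \<in> I \<Longrightarrow> F i \<in> boolean_algebra_subgroups G) \<Longrightarrow>
    (\<Union>i\<in>I. F i) \<in> boolean_algebra_subgroups G"
  by (induction I rule: finite_induct)
    (auto intro: boolean_algebra_empty boolean_algebra_subgroups.union)

text \<open>The generators of a cyclic group are its elements lying in none of its proper cyclic
  subgroups.\<close>

lemma gens_in_boolean_algebra:
  assumes x: "x \<in> carrier G"
  shows "gens x \<in> boolean_algebra_subgroups G"
proof -
  let ?P = "{y \<in> generate G {x}. generate G {y} \<noteq> generate G {x}}"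
  have PG: "?P \<subseteq> carrier G" using generate_subset_carrier[OF x] by blast
  have "gens x = generate G {x} \<inter> (carrier G - (\<Union>y\<in>?P. generate G {y}))"
  proof (intro equalityI subsetI)
    fix z assume z: "z \<in> gens x"
    have "z \<notin> generate G {y}" if "y \<in> ?P" for y
    proof
      assume "z \<in> generate G {y}"
      then have "generate G {z} \<subseteq> generate G {y}" using that PG generate_mono1 by blast
      moreover have "generate G {y} \<subseteq> generate G {x}" using that generate_mono1[OF x] by blast
      ultimately show False using that z by (auto simp: gens_def)
    qed
    then show "z \<in> generate G {x} \<inter> (carrier G - (\<Union>y\<in>?P. generate G {y}))"
      using z gens_subset_generate[of x] by (auto simp: gens_def)
  next
    fix z assume z: "z \<in> generate G {x} \<inter> (carrier G - (\<Union>y\<in>?P. generate G {y}))"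
    then have "z \<notin> ?P" using in_generate_self by blast
    then show "z \<in> gens x" using z by (auto simp: gens_def)
  qed
  moreover have "finite ?P" using PG finite_carrier finite_subset by blast
  then have "(\<Union>y\<in>?P. generate G {y}) \<in> boolean_algebra_subgroups G"
    using PG by (intro boolean_algebra_Union boolean_algebra_subgroups.subgroup generate_subgroup) auto
  then have "generate G {x} \<inter> (carrier G - (\<Union>y\<in>?P. generate G {y})) \<in> boolean_algebra_subgroups G"
    by (intro boolean_algebra_subgroups.inter boolean_algebra_subgroups.complement
        boolean_algebra_subgroups.subgroup[OF generate_subgroup[OF x]])
  ultimately show ?thesis by (simp only:)
qed

lemma boolean_algebra_iff_gens_closed:
  "A \<in> boolean_algebra_subgroups G \<longleftrightarrow> gens_closed A"
proof
  assume "A \<in> boolean_algebra_subgroups G"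
  \<comment> \<open>Membership depends only on the cyclic subgroup generated by an element. The
    equivalence, unlike a bare implication, passes directly to complements.\<close>
  then have "A \<subseteq> carrier G \<and> (\<forall>x\<in>carrier G. \<forall>y\<in>gens x. x \<in> A \<longleftrightarrow> y \<in> A)"
  proof induction
    case (subgroup H)
    have "x \<in> H \<longleftrightarrow> generate G {x} \<subseteq> H" if "x \<in> carrier G" for x
      using generate_subgroup_incl[OF _ subgroup, of "{x}"] in_generate_self[OF that] by blast
    then show ?case using subgroup.subset[OF subgroup] by (auto simp: gens_def)
  next
    case (inter A B)
    then show ?case by blast
  next
    case (union A B)
    then show ?case by blast
  next
    case (complement A)
    moreover have "gens x \<subseteq> carrier G" for x by (auto simp: gens_def)
    ultimately show ?case by blast
  qed
  then show "gens_closed A" unfolding gens_closed_def by blast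
next
  assume A: "gens_closed A"
  then have "A = (\<Union>x\<in>A. gens x)" unfolding gens_closed_def using gens_self by blast
  moreover have "finite A" using A finite_carrier finite_subset unfolding gens_closed_def by blast
  moreover have "gens x \<in> boolean_algebra_subgroups G" if "x \<in> A" for x
    using that A gens_in_boolean_algebra unfolding gens_closed_def by blast
  ultimately show "A \<in> boolean_algebra_subgroups G" using boolean_algebra_Union by metis
qed

section \<open>Integer combinations of characters of cyclic subgroups\<close>

text \<open>\<open>Q\<close> cuts out an additive subgroup of the functions on the group. Proving
  \<open>Q\<close> from its truth on characters replaces an explicit integer combination; in the
  application \<open>Q\<close> says that a trace is an integer.\<close>

definition subtractive :: "(('a \<Rightarrow> complex) \<Rightarrow> bool) \<Rightarrow> bool" where
  "subtractive Q \<longleftrightarrow> Q (\<lambda>_. 0) \<and> (\<forall>h g. Q h \<longrightarrow> Q g \<longrightarrow> Q (\<lambda>z. h z - g z))"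

lemma subtractive_add:
  assumes "subtractive Q" "Q h" "Q g"
  shows "Q (\<lambda>z. h z + g z)"
proof -
  have "Q (\<lambda>z. 0 - g z)" using assms unfolding subtractive_def by blast
  then have "Q (\<lambda>z. h z - (0 - g z))" using assms unfolding subtractive_def by blast
  then show ?thesis by simp
qed

lemma subtractive_gens_closed:
  assumes Q: "subtractive Q" and U: "gens_closed U"
    and gens: "\<And>x. x \<in> U \<Longrightarrow> Q (extend0 (gens x) h)"
  shows "Q (extend0 U h)"
  using U gens
proof (induction "card U" arbitrary: U rule: less_induct)
  case less
  have fin: "finite U"
    using less.prems(1) finite_carrier finite_subset unfolding gens_closed_def by blast
  show ?case
  proof (cases "U = {}")
    case True
    then show ?thesis using Q by (simp add: extend0_def[abs_def] subtractive_def)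
  next
    case False
    then obtain x where x: "x \<in> U" by blast
    have xc: "x \<in> carrier G" and sub: "gens x \<subseteq> U"
      using x less.prems(1) unfolding gens_closed_def by auto
    have closed: "gens_closed (U - gens x)"
      using less.prems(1) gens_eq unfolding gens_closed_def by (auto simp: gens_def)
    have "card (U - gens x) < card U"
      using x gens_self[OF xc] fin by (intro psubset_card_mono) auto
    then have "Q (extend0 (U - gens x) h)" using less.hyps closed less.prems(2) by blast
    then have "Q (\<lambda>z. extend0 (U - gens x) h z + extend0 (gens x) h z)"
      using subtractive_add[OF Q] less.prems(2)[OF x] by blast
    moreover have "(\<lambda>z. extend0 (U - gens x) h z + extend0 (gens x) h z) = extend0 U h"
      using sub by (auto simp: extend0_def fun_eq_iff)
    ultimately show ?thesis by simp
  qed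
qed

text \<open>Induction on the order in place of Moebius inversion: the non-generators of the cyclic
  group split into classes of generators of smaller subgroups, to which \<open>\<theta>\<close>
  restricts as a character.\<close>

lemma subtractive_character_gens:
  assumes Q: "subtractive Q"
    and char: "\<And>x \<theta>. x \<in> carrier G \<Longrightarrow>
      (\<And>a b. a \<in> generate G {x} \<Longrightarrow> b \<in> generate G {x} \<Longrightarrow> \<theta> (a \<otimes> b) = \<theta> a * \<theta> b) \<Longrightarrow>
      Q (extend0 (generate G {x}) \<theta>)"
    and x: "x \<in> carrier G"
    and \<theta>: "\<And>a b. a \<in> generate G {x} \<Longrightarrow> b \<in> generate G {x} \<Longrightarrow> \<theta> (a \<otimes> b) = \<theta> a * \<theta> b"
  shows "Q (extend0 (gens x) \<theta>)"
  using x \<theta>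
proof (induction "ord x" arbitrary: x rule: less_induct)
  case less
  note x = less.prems(1)
  let ?U = "generate G {x} - gens x"
  have closed: "gens_closed ?U"
    unfolding gens_closed_def
  proof (intro conjI ballI)
    show "?U \<subseteq> carrier G" using generate_subset_carrier[OF x] by blast
    fix y assume y: "y \<in> ?U"
    then have "gens y \<subseteq> generate G {x}"
      using gens_subset_generate generate_mono1[OF x] by blast
    moreover have "gens y \<inter> gens x = {}"
      using y generate_subset_carrier[OF x] by (auto simp: gens_def)
    ultimately show "gens y \<subseteq> ?U" by blast
  qed
  have "Q (extend0 ?U \<theta>)"
  proof (rule subtractive_gens_closed[OF Q closed])
    fix y assume y: "y \<in> ?U"
    then have yc: "y \<in> carrier G" and sub: "generate G {y} \<subseteq> generate G {x}"
      using generate_subset_carrier[OF x] generate_mono1[OF x] by auto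
    have "generate G {y} \<noteq> generate G {x}" using y yc by (auto simp: gens_def)
    then have "card (generate G {y}) < card (generate G {x})"
      using sub generate_subset_carrier[OF x] finite_carrier
      by (intro psubset_card_mono) (auto intro: finite_subset)
    then have "ord y < ord x" using generate_pow_card x yc by simp
    then show "Q (extend0 (gens y) \<theta>)"
      using less.hyps[OF _ yc] less.prems(2) sub by blast
  qed
  moreover have "Q (extend0 (generate G {x}) \<theta>)" using char[OF x less.prems(2)] .
  ultimately have "Q (\<lambda>z. extend0 (generate G {x}) \<theta> z - extend0 ?U \<theta> z)"
    using Q unfolding subtractive_def by blast
  moreover have "(\<lambda>z. extend0 (generate G {x}) \<theta> z - extend0 ?U \<theta> z) = extend0 (gens x) \<theta>"
    using gens_subset_generate[of x] by (auto simp: extend0_def fun_eq_iff)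
  ultimately show ?case by simp
qed

subsection \<open>The symbol of the Hermitian adjacency matrix\<close>

definition hermitian2_symbol :: "'a set \<Rightarrow> 'a \<Rightarrow> complex" where
  "hermitian2_symbol S z =
    (if z \<in> S \<and> inv z \<in> S then 1 else if z \<in> S then \<omega> else if inv z \<in> S then cnj \<omega> else 0)"

lemma hermitian2_symbol_values: "hermitian2_symbol S z \<in> hermitian2_values"
  by (simp add: hermitian2_symbol_def hermitian2_values_def)

lemma hermitian2_symbol_eq_1_iff: "hermitian2_symbol S z = 1 \<longleftrightarrow> z \<in> S - directed_part G S"
  by (auto simp: hermitian2_symbol_def directed_part_def)

lemma hermitian2_symbol_eq_omega_iff: "hermitian2_symbol S z = \<omega> \<longleftrightarrow> z \<in> directed_part G S"
  using omega_neq(2) omega_neq(1)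
  by (auto simp: hermitian2_symbol_def directed_part_def dest: sym)

lemma hermitian2_symbol_inv_directed:
  assumes "z \<in> carrier G" "inv z \<in> directed_part G S"
  shows "hermitian2_symbol S z = cnj \<omega>"
  using assms by (auto simp: hermitian2_symbol_def directed_part_def)

lemma hermitian2_matrix_mixed_cayley_graph:
  "hermitian2_matrix (mixed_cayley_graph G S) vs = conv_mat (hermitian2_symbol S)"
proof (rule eq_matI)
  fix i j assume "i < dim_row (conv_mat (hermitian2_symbol S))"
    "j < dim_col (conv_mat (hermitian2_symbol S))"
  then have ij: "i < length vs" "j < length vs" by (auto simp: conv_mat_def)
  then have "inv (vs ! j \<otimes> inv (vs ! i)) = vs ! i \<otimes> inv (vs ! j)"
    by (simp add: inv_mult_group)
  then show "hermitian2_matrix (mixed_cayley_graph G S) vs $$ (i, j) =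
      conv_mat (hermitian2_symbol S) $$ (i, j)"
    using ij
    by (simp add: hermitian2_matrix_def hermitian2_entry_def mixed_cayley_graph_def conv_mat_def
        hermitian2_symbol_def cnj_omega \<omega>_def)
qed (auto simp: hermitian2_matrix_def conv_mat_def)

lemma conjugation_mem_iff:
  assumes S: "union_of_conjugacy_classes G S" and a: "a \<in> carrier G" and z: "z \<in> carrier G"
  shows "a \<otimes> z \<otimes> inv a \<in> S \<longleftrightarrow> z \<in> S"
proof -
  have imp: "b \<otimes> w \<otimes> inv b \<in> S" if bw: "b \<in> carrier G" "w \<in> S" for b w
  proof -
    obtain X where X: "X \<subseteq> carrier G" "S = (\<Union>x\<in>X. conjugacy_class G x)"
      using S unfolding union_of_conjugacy_classes_def by blast
    then obtain x g where xg: "x \<in> X" "g \<in> carrier G" "w = g \<otimes> x \<otimes> inv g"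
      using bw(2) unfolding conjugacy_class_def by blast
    have "b \<otimes> w \<otimes> inv b = (b \<otimes> g) \<otimes> x \<otimes> inv (b \<otimes> g)"
      using xg X(1) bw(1) by (auto simp: inv_mult_group m_assoc)
    then show ?thesis using xg bw(1) X(2) unfolding conjugacy_class_def by blast
  qed
  have "inv a \<otimes> (a \<otimes> z \<otimes> inv a) \<otimes> inv (inv a) = z"
    using a z by (simp add: m_assoc)
  then show ?thesis using imp a by (metis inv_closed)
qed

lemma hermitian2_symbol_class_function:
  assumes S: "union_of_conjugacy_classes G S" and a: "a \<in> carrier G" and z: "z \<in> carrier G"
  shows "hermitian2_symbol S (a \<otimes> z \<otimes> inv a) = hermitian2_symbol S z"
proof -
  have "inv (a \<otimes> z \<otimes> inv a) = a \<otimes> inv z \<otimes> inv a"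
    using a z by (simp add: inv_mult_group m_assoc)
  then show ?thesis
    using conjugation_mem_iff[OF S a z] conjugation_mem_iff[OF S a inv_closed[OF z]]
    by (simp add: hermitian2_symbol_def)
qed

section \<open>The classes of elements of order divisible by 3\<close>

lemma int_pow_eq_nat_pow:
  assumes x: "x \<in> carrier G"
  obtains k' :: nat where "x [^] (k :: int) = x [^] k'" "[int k' = k] (mod int (ord x))"
proof
  have o: "ord x > 0" using ord_pos[OF x] .
  define k' where "k' = nat (k mod int (ord x))"
  have k': "int k' = k mod int (ord x)" using o by (simp add: k'_def)
  then show "[int k' = k] (mod int (ord x))" by (simp add: cong_def)
  then have "x [^] int k' = x [^] k"
    using int_pow_eq[OF x] by (simp add: cong_iff_dvd_diff dvd_diff_commute)
  then show "x [^] k = x [^] k'" by (simp add: int_pow_int)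
qed

text \<open>An integer exponent may be reduced modulo \<open>ord x\<close>; as 3 divides the order,
  its residue modulo 3 survives.\<close>

lemma class3_eq_nat_powers:
  assumes x: "x \<in> elements_of_order_div3 G"
  shows "class3 G x = {x [^] k | k :: nat. coprime k (ord x) \<and> [k = 1] (mod 3)}"
proof (intro equalityI subsetI)
  have xc: "x \<in> carrier G" and 3: "3 dvd ord x"
    using x by (auto simp: elements_of_order_div3_def)
  {
    fix y assume "y \<in> class3 G x"
    then obtain k :: int where k: "y = x [^] k" "coprime k (int (ord x))" "[k = 1] (mod 3)"
      unfolding class3_def equiv3_def by auto
    obtain k' :: nat where k': "x [^] k = x [^] k'" "[int k' = k] (mod int (ord x))"
      using int_pow_eq_nat_pow[OF xc] by blast
    have "coprime (int k') (int (ord x))"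
      using k(2) cong_imp_coprime[OF cong_sym[OF k'(2)]] by blast
    then have "coprime k' (ord x)" by simp
    moreover have "[int k' = k] (mod 3)"
      using cong_dvd_modulus[OF k'(2), of 3] 3 by (metis int_dvd_int_iff of_nat_numeral)
    then have "[int k' = int 1] (mod int 3)" using k(3) cong_trans by (metis of_nat_1 of_nat_numeral)
    then have "[k' = 1] (mod 3)" by (simp only: cong_int_iff)
    ultimately show "y \<in> {x [^] k | k :: nat. coprime k (ord x) \<and> [k = 1] (mod 3)}"
      using k(1) k'(1) by blast
  next
    fix y assume "y \<in> {x [^] k | k :: nat. coprime k (ord x) \<and> [k = 1] (mod 3)}"
    then obtain k :: nat where k: "y = x [^] k" "coprime k (ord x)" "[k = 1] (mod 3)" by blast
    have "ord y = ord x" unfolding k(1) using pow_ord_eq_ord_iff[OF finite_carrier xc] k(2) by blast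
    then have "y \<in> elements_of_order_div3 G"
      using 3 xc k(1) by (simp add: elements_of_order_div3_def)
    moreover have "[int k = int 1] (mod int 3)" using k(3) by (simp only: cong_int_iff)
    then have "equiv3 G x y"
      unfolding equiv3_def using k by (intro exI[of _ "int k"]) (simp add: int_pow_int)
    ultimately show "y \<in> class3 G x" by (simp add: class3_def)
  }
qed

lemma class3_self: "x \<in> elements_of_order_div3 G \<Longrightarrow> x \<in> class3 G x"
proof -
  assume x: "x \<in> elements_of_order_div3 G"
  then have "x = x [^] (1 :: nat)" by (simp add: elements_of_order_div3_def)
  then show ?thesis unfolding class3_eq_nat_powers[OF x] by (auto intro!: exI[of _ "1 :: nat"])
qed

lemma power_in_class3:
  assumes x: "x \<in> elements_of_order_div3 G" and y: "y \<in> class3 G x"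
    and k: "coprime k (ord y)" "[k = 1] (mod 3)"
  shows "y [^] (k :: nat) \<in> class3 G x"
proof -
  have xc: "x \<in> carrier G" using x by (simp add: elements_of_order_div3_def)
  obtain a :: nat where a: "y = x [^] a" "coprime a (ord x)" "[a = 1] (mod 3)"
    using y unfolding class3_eq_nat_powers[OF x] by blast
  have "ord y = ord x" unfolding a(1) using pow_ord_eq_ord_iff[OF finite_carrier xc] a(2) by blast
  then have "coprime (a * k) (ord x)" using a(2) k(1) by simp
  moreover have "[a * k = 1] (mod 3)" using cong_mult[OF a(3) k(2)] by simp
  moreover have "y [^] k = x [^] (a * k)" unfolding a(1) using xc by (simp add: nat_pow_pow)
  ultimately show ?thesis unfolding class3_eq_nat_powers[OF x] by blast
qed

lemma skew_symmetric_unions3_power: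
  assumes D: "D \<in> skew_symmetric_unions3 G" and y: "y \<in> D"
  shows "y \<in> elements_of_order_div3 G"
    and "coprime k (ord y) \<Longrightarrow> [k = 1] (mod 3) \<Longrightarrow> y [^] (k :: nat) \<in> D"
proof -
  obtain X where X: "X \<subseteq> elements_of_order_div3 G" "D = (\<Union>x\<in>X. class3 G x)"
    using D unfolding skew_symmetric_unions3_def by blast
  then obtain x where x: "x \<in> X" "y \<in> class3 G x" using y by blast
  then show "y \<in> elements_of_order_div3 G" by (simp add: class3_def)
  show "y [^] k \<in> D" if "coprime k (ord y)" "[k = 1] (mod 3)"
    using power_in_class3[OF _ x(2) that] x X by blast
qed

section \<open>Necessity of the two conditions\<close>

text \<open>Both parts are read off from the power rule for the symbol: the value 1 is fixed by all
  exponents prime to \<open>6 * ord x\<close>, and \<omega> by those that are also 1 modulo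
  3.\<close>

lemma
  assumes S: "S \<subseteq> carrier G" "union_of_conjugacy_classes G S"
    and ev: "\<And>e. eigenvalue (conv_mat (hermitian2_symbol S)) e \<Longrightarrow> e \<in> \<int>"
  shows integral_imp_boolean_algebra: "S - directed_part G S \<in> boolean_algebra_subgroups G"
    and integral_imp_skew_symmetric_unions3: "directed_part G S \<in> skew_symmetric_unions3 G"
proof -
  let ?f = "hermitian2_symbol S" and ?D = "directed_part G S"
  have pow: "?f (x [^] k) = ?f x ^ k" if "x \<in> carrier G" "coprime k (6 * ord x)" for x k
    by (rule integral_spectrum_power[OF hermitian2_symbol_class_function[OF S(2)]
          hermitian2_symbol_values ev that])
  have DG: "?D \<subseteq> carrier G" using S(1) by (auto simp: directed_part_def)
  \<comment> \<open>The power rule needs exponents prime to 6 as well; changing the exponent by a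
    multiple of the order achieves this.\<close>
  have pow_cong: "\<exists>k'. x [^] k = x [^] k' \<and> [k' = k] (mod ord x) \<and> coprime k' (6 * ord x)"
    if "x \<in> carrier G" "coprime k (ord x)" for x and k :: nat
    using coprime_representative_coprime_6[OF that(2)] pow_eq_pow_iff_cong[OF that(1)] cong_sym by metis
  have "gens_closed (S - ?D)"
    unfolding gens_closed_def
  proof (intro conjI ballI subsetI)
    fix x y assume x: "x \<in> S - ?D" and y: "y \<in> gens x"
    then have xc: "x \<in> carrier G" using S(1) by blast
    obtain k :: nat where "y = x [^] k" "coprime k (ord x)"
      using generator_is_coprime_power[OF xc y] .
    then obtain k' where "y = x [^] k'" "coprime k' (6 * ord x)" using pow_cong[OF xc] by blast
    then show "y \<in> S - ?D"
      using pow[OF xc] x hermitian2_symbol_eq_1_iff by (metis power_one)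
  qed (use S(1) in blast)
  then show "S - ?D \<in> boolean_algebra_subgroups G" using boolean_algebra_iff_gens_closed by blast
  have div3: "?D \<subseteq> elements_of_order_div3 G"
  proof
    fix x assume x: "x \<in> ?D"
    then have xc: "x \<in> carrier G" using DG by blast
    let ?n = "ord x"
    have "3 dvd ?n"
    proof (rule ccontr)
      assume n3: "\<not> 3 dvd ?n"
      \<comment> \<open>If 3 does not divide the order, this odd \<open>k\<close> is 1 modulo the
        order and 2 modulo 3. Then \<open>x [^] k\<close> is \<open>x\<close>, whereas the power
        rule conjugates the value \<omega>.\<close>
      define k where "k = 1 + 4 * ?n * ?n"
      have n: "[?n * ?n = 1] (mod 3)"
      proof -
        have "?n mod 3 = 1 \<or> ?n mod 3 = 2"
          using n3 mod_less_divisor[of 3 ?n] unfolding dvd_eq_mod_eq_0 by linarith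
        then show ?thesis unfolding cong_def using mod_mult_eq[of ?n 3 ?n] by auto
      qed
      then have "[k = 1 + 4 * 1] (mod 3)"
        unfolding k_def mult.assoc by (intro cong_add cong_mult) auto
      then have k2: "[k = 2] (mod 3)" by (simp add: cong_def)
      have odd: "odd k" by (simp add: k_def)
      have "coprime k 2" using odd by (simp add: coprime_right_2_iff_odd)
      moreover have "\<not> 3 dvd k" using k2 by (simp add: cong_def dvd_eq_mod_eq_0)
      then have "coprime 3 k" by (intro prime_imp_coprime) simp_all
      then have "coprime k 3" by (simp only: coprime_commute)
      moreover have "coprime k ?n"
      proof (rule coprimeI)
        fix d assume d: "d dvd k" "d dvd ?n"
        then have "d dvd 4 * ?n * ?n" by simp
        then show "is_unit d" using d(1) unfolding k_def by (metis dvd_add_left_iff)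
      qed
      moreover have "(6 :: nat) * ?n = 2 * 3 * ?n" by simp
      ultimately have "coprime k (6 * ?n)" by (simp only: coprime_mult_right_iff)
      then have "?f (x [^] k) = ?f x ^ k" by (rule pow[OF xc])
      moreover have "x [^] k = x [^] (1 :: nat)"
      proof -
        have "k = 1 + ?n * (4 * ?n)" by (simp add: k_def)
        then show ?thesis
          unfolding pow_eq_pow_iff_cong[OF xc] cong_def by (simp only: mod_mult_self2)
      qed
      moreover have "?f x = \<omega>" using x hermitian2_symbol_eq_omega_iff by blast
      ultimately have "cnj \<omega> = \<omega>" using omega_power_odd(2)[OF odd k2] xc by simp
      then show False by simp
    qed
    then show "x \<in> elements_of_order_div3 G" using xc by (simp add: elements_of_order_div3_def)
  qed
  have "?D = (\<Union>x\<in>?D. class3 G x)"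
  proof (intro equalityI subsetI)
    fix y assume "y \<in> (\<Union>x\<in>?D. class3 G x)"
    then obtain x where x: "x \<in> ?D" "y \<in> class3 G x" by blast
    then have x3: "x \<in> elements_of_order_div3 G" using div3 by blast
    then have xc: "x \<in> carrier G" and 3: "3 dvd ord x" by (auto simp: elements_of_order_div3_def)
    obtain k :: nat where k: "y = x [^] k" "coprime k (ord x)" "[k = 1] (mod 3)"
      using x(2) unfolding class3_eq_nat_powers[OF x3] by blast
    obtain k' where k': "y = x [^] k'" "[k' = k] (mod ord x)" "coprime k' (6 * ord x)"
      using pow_cong[OF xc k(2)] k(1) by blast
    have "[k' = 1] (mod 3)" using cong_trans[OF cong_dvd_modulus_nat[OF k'(2) 3] k(3)] .
    moreover have "odd k'" using coprime_imp_not_dvd[OF k'(3), of 2] by simp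
    ultimately have "?f y = \<omega>"
      using omega_power_odd(1) pow[OF xc k'(3)] k'(1) x(1) hermitian2_symbol_eq_omega_iff by metis
    then show "y \<in> ?D" using hermitian2_symbol_eq_omega_iff by blast
  qed (use class3_self div3 in blast)
  moreover have "finite ?D" using DG finite_carrier finite_subset by blast
  moreover have "skew_symmetric G ?D"
    unfolding skew_symmetric_def using DG by (auto simp: directed_part_def)
  ultimately show "?D \<in> skew_symmetric_unions3 G"
    unfolding skew_symmetric_unions3_def using div3 by blast
qed

text \<open>As \<open>1 + \<omega>\<^sup>2 = \<omega>\<close> and \<open>1 + \<omega>\<^sup>4 = cnj \<omega>\<close>, a cubic character accounts for the two values of the
  symbol on the generators.\<close>

lemma hermitian2_symbol_on_directed_gens:
  assumes S: "S \<subseteq> carrier G" and D: "directed_part G S \<in> skew_symmetric_unions3 G"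
    and x: "x \<in> directed_part G S"
    and \<theta>: "\<And>j :: nat. \<theta> (x [^] j) = (\<omega> ^ 2) ^ j" and y: "y \<in> gens x"
  shows "hermitian2_symbol S y = 1 + \<theta> y"
proof -
  have xc: "x \<in> carrier G" using S x by (auto simp: directed_part_def)
  have 3: "3 dvd ord x"
    using skew_symmetric_unions3_power(1)[OF D x] by (simp add: elements_of_order_div3_def)
  obtain k :: nat where k: "y = x [^] k" "coprime k (ord x)"
    using generator_is_coprime_power[OF xc y] .
  have per: "(\<omega> ^ 2) ^ k = (\<omega> ^ 2) ^ (k mod 3)"
  proof -
    have "(\<omega> ^ 2) ^ 3 = \<omega> ^ 6" by (simp flip: power_mult)
    then have 1: "(\<omega> ^ 2) ^ 3 = 1" by (simp only: omega_sixth_power)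
    have "(\<omega> ^ 2) ^ k = (\<omega> ^ 2) ^ (3 * (k div 3) + k mod 3)" by simp
    also have "\<dots> = (\<omega> ^ 2) ^ (k mod 3)" unfolding power_add power_mult[of _ 3] 1 by simp
    finally show ?thesis .
  qed
  have "\<not> 3 dvd k" using coprime_imp_not_dvd[OF k(2) 3] by simp
  then have "[k = 1] (mod 3) \<or> [k = 2] (mod 3)"
    using mod_less_divisor[of 3 k]
    unfolding cong_def dvd_eq_mod_eq_0 by (simp del: mod_less_divisor) linarith
  then show ?thesis
  proof
    assume k1: "[k = 1] (mod 3)"
    then have "y \<in> directed_part G S"
      using skew_symmetric_unions3_power(2)[OF D x k(2)] k(1) by simp
    then have "hermitian2_symbol S y = \<omega>" using hermitian2_symbol_eq_omega_iff by blast
    moreover have "\<theta> y = \<omega> - 1"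
      unfolding k(1) \<theta> per using k1 by (simp add: cong_def omega_square)
    ultimately show ?thesis by simp
  next
    assume k2: "[k = 2] (mod 3)"
    \<comment> \<open>A natural exponent for \<open>inv y\<close>. It is minus \<open>k\<close>
      modulo the order, hence 1 modulo 3, which puts \<open>inv y\<close> in the directed
      part.\<close>
    define m where "m = ord x - k mod ord x"
    have inv: "inv y = x [^] m"
    proof -
      have "x [^] m \<otimes> y = x [^] (m + k mod ord x)"
        unfolding k(1) using xc pow_mod_ord[OF xc, of k] by (simp add: nat_pow_mult[symmetric])
      also have "m + k mod ord x = ord x" using ord_pos[OF xc] by (simp add: m_def less_imp_le)
      finally have "x [^] m \<otimes> y = \<one>" using xc by simp
      then show ?thesis using xc k(1) inv_equality by simp
    qed
    have "inv y \<in> gens x"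
      using inv_in_gens y gens_eq[OF y] by (auto simp: gens_def)
    then have "ord (x [^] m) = ord x"
      unfolding inv using generate_pow_card[of "x [^] m"] generate_pow_card[OF xc] xc
      by (simp add: gens_def)
    then have cop: "coprime m (ord x)" using pow_ord_eq_ord_iff[OF finite_carrier xc] by blast
    have "[m + k mod ord x = 0] (mod 3)"
      using 3 ord_pos[OF xc] by (simp add: m_def less_imp_le cong_def)
    moreover have "k mod ord x mod 3 = 2"
      using k2 3 by (simp add: mod_mod_cancel cong_def)
    ultimately have "[m = 1] (mod 3)"
    proof -
      assume a: "[m + k mod ord x = 0] (mod 3)" and b: "k mod ord x mod 3 = 2"
      have "(m mod 3 + 2) mod 3 = 0" using a b by (metis cong_def mod_add_eq mod_0)
      moreover have "m mod 3 = 0 \<or> m mod 3 = 1 \<or> m mod 3 = 2"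
        using mod_less_divisor[of 3 m] by linarith
      ultimately show ?thesis unfolding cong_def by (elim disjE) simp_all
    qed
    then have "inv y \<in> directed_part G S"
      using skew_symmetric_unions3_power(2)[OF D x cop] inv by simp
    then have "hermitian2_symbol S y = cnj \<omega>"
      using hermitian2_symbol_inv_directed xc k(1) by simp
    moreover have "\<theta> y = (\<omega> ^ 2) ^ 2"
      unfolding k(1) \<theta> per using k2 by (simp add: cong_def)
    moreover have "(\<omega> ^ 2) ^ 2 = - \<omega>"
      by (simp add: power2_eq_square omega_mult_omega algebra_simps)
    ultimately show ?thesis by (simp add: omega_plus_cnj)
  qed
qed

section \<open>Sufficiency of the two conditions\<close>

text \<open>On each class of generators the symbol is 0, or 1, or the sum of the trivial and a cubic
  character, the latter normalised at a directed element.\<close>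

lemma subtractive_hermitian2_symbol:
  assumes Q: "subtractive Q"
    and char: "\<And>x \<theta>. x \<in> carrier G \<Longrightarrow>
      (\<And>a b. a \<in> generate G {x} \<Longrightarrow> b \<in> generate G {x} \<Longrightarrow> \<theta> (a \<otimes> b) = \<theta> a * \<theta> b) \<Longrightarrow>
      Q (extend0 (generate G {x}) \<theta>)"
    and S: "S \<subseteq> carrier G"
    and T: "S - directed_part G S \<in> boolean_algebra_subgroups G"
    and D: "directed_part G S \<in> skew_symmetric_unions3 G"
  shows "Q (extend0 (carrier G) (hermitian2_symbol S))"
proof (rule subtractive_gens_closed[OF Q])
  show "gens_closed (carrier G)" by (auto simp: gens_closed_def gens_def)
  fix x assume x: "x \<in> carrier G"
  let ?f = "hermitian2_symbol S"
  note gen = subtractive_character_gens[OF Q char]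
  have one: "Q (extend0 (gens x) (\<lambda>_. 1))" if "x \<in> carrier G" for x
    by (rule gen[OF _ _ that]) auto
  have directed: "Q (extend0 (gens y) ?f)" if y: "y \<in> directed_part G S" for y
  proof -
    have yc: "y \<in> carrier G" using S y by (auto simp: directed_part_def)
    have "3 dvd ord y"
      using skew_symmetric_unions3_power(1)[OF D y] by (simp add: elements_of_order_div3_def)
    then obtain q where q: "ord y = 3 * q" by blast
    have "(\<omega> ^ 2) ^ ord y = (\<omega> ^ 6) ^ q"
      unfolding q by (simp flip: power_mult)
    then have "(\<omega> ^ 2) ^ ord y = 1" by (simp only: omega_sixth_power power_one)
    then obtain \<theta> where \<theta>: "\<And>j :: nat. \<theta> (y [^] j) = (\<omega> ^ 2) ^ j"
      "\<And>a b. a \<in> generate G {y} \<Longrightarrow> b \<in> generate G {y} \<Longrightarrow> \<theta> (a \<otimes> b) = \<theta> a * \<theta> b"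
      using cyclic_character_exists[OF yc] by blast
    have "Q (\<lambda>z. extend0 (gens y) (\<lambda>_. 1) z + extend0 (gens y) \<theta> z)"
      by (rule subtractive_add[OF Q one[OF yc] gen[OF _ _ yc \<theta>(2)]]) auto
    moreover have "(\<lambda>z. extend0 (gens y) (\<lambda>_. 1) z + extend0 (gens y) \<theta> z) = extend0 (gens y) ?f"
      using hermitian2_symbol_on_directed_gens[OF S D y \<theta>(1)] by (auto simp: extend0_def fun_eq_iff)
    ultimately show ?thesis by simp
  qed
  \<comment> \<open>The third case reduces to the second, because \<open>y\<close> and
    \<open>inv y\<close> generate the same subgroup.\<close>
  consider y where "y \<in> gens x" "y \<in> S - directed_part G S"
    | y where "y \<in> gens x" "y \<in> directed_part G S"
    | y where "y \<in> gens x" "inv y \<in> directed_part G S"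
    | "\<And>y. y \<in> gens x \<Longrightarrow> ?f y = 0"
    unfolding hermitian2_symbol_def directed_part_def by (auto simp: gens_def) metis
  then show "Q (extend0 (gens x) ?f)"
  proof cases
    case 1
    have "gens x \<subseteq> S - directed_part G S"
      using 1 T gens_eq[OF 1(1)] unfolding boolean_algebra_iff_gens_closed gens_closed_def by blast
    then have "extend0 (gens x) ?f = extend0 (gens x) (\<lambda>_. 1)"
      using hermitian2_symbol_eq_1_iff by (auto simp: extend0_def fun_eq_iff)
    then show ?thesis using one[OF x] by simp
  next
    case 2
    then show ?thesis using directed gens_eq by metis
  next
    case 3
    have "y \<in> carrier G" using 3(1) by (simp add: gens_def)
    then have "gens (inv y) = gens x" using 3(1) gens_eq inv_in_gens by metis
    then show ?thesis using directed[OF 3(2)] by simp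
  next
    case 4
    then have "extend0 (gens x) ?f = (\<lambda>_. 0)" by (auto simp: extend0_def fun_eq_iff)
    then show ?thesis using Q by (simp add: subtractive_def)
  qed
qed

text \<open>The trace on the generalised eigenspace is an integer for characters of cyclic
  subgroups, hence for the symbol, where it equals \<open>m * l\<close>. So \<open>l\<close> is
  rational, and it is an algebraic integer.\<close>

lemma integral_if_unions:
  assumes S: "S \<subseteq> carrier G" "union_of_conjugacy_classes G S"
    and T: "S - directed_part G S \<in> boolean_algebra_subgroups G"
    and D: "directed_part G S \<in> skew_symmetric_unions3 G"
    and l: "eigenvalue (conv_mat (hermitian2_symbol S)) l"
  shows "l \<in> \<int>"
proof -
  let ?f = "hermitian2_symbol S" and ?n = "length vs"
  obtain m \<phi> where m: "m > 0" and tr: "mat_tr (\<phi> (conv_mat ?f)) = of_nat m * l"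
    and \<phi>: "\<And>N. \<phi> N \<in> carrier_mat m m"
    and add: "\<And>N N'. N \<in> carrier_mat ?n ?n \<Longrightarrow> N' \<in> carrier_mat ?n ?n \<Longrightarrow> \<phi> (N + N') = \<phi> N + \<phi> N'"
    and smult: "\<And>c N. N \<in> carrier_mat ?n ?n \<Longrightarrow> \<phi> (c \<cdot>\<^sub>m N) = c \<cdot>\<^sub>m \<phi> N"
    and mult: "\<And>N N'. N \<in> carrier_mat ?n ?n \<Longrightarrow> N' \<in> carrier_mat ?n ?n \<Longrightarrow>
      N' * conv_mat ?f = conv_mat ?f * N' \<Longrightarrow> \<phi> (N * N') = \<phi> N * \<phi> N'"
    by (rule generalised_eigenspace_restriction[OF conv_mat_carrier l])
      (rule that; (assumption | blast))
  define Q where "Q h \<longleftrightarrow> mat_tr (\<phi> (conv_mat h)) \<in> \<int>" for h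
  \<comment> \<open>The scalar \<open>c\<close> lets one identity yield both the zero function
    (\<open>c = 1\<close>) and differences (\<open>c = - 1\<close>).\<close>
  have tr_lin: "mat_tr (\<phi> (conv_mat (\<lambda>z. h z + c * g z))) =
      mat_tr (\<phi> (conv_mat h)) + c * mat_tr (\<phi> (conv_mat g))" for h g c
    using \<phi>[of "conv_mat h"] \<phi>[of "conv_mat g"]
    unfolding conv_mat_add conv_mat_smult
    by (subst add) (auto simp: smult mat_tr_def sum.distrib sum_distrib_left)
  have "subtractive Q"
    unfolding subtractive_def
  proof (intro conjI allI impI)
    have "mat_tr (\<phi> (conv_mat (\<lambda>_. 0))) = 0"
      using tr_lin[of "\<lambda>_. 0" 1 "\<lambda>_. 0"] by simp
    then show "Q (\<lambda>_. 0)" by (simp add: Q_def)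
    fix h g assume "Q h" "Q g"
    then show "Q (\<lambda>z. h z - g z)" unfolding Q_def using tr_lin[of h "- 1" g] by simp
  qed
  moreover have "Q (extend0 (generate G {x}) \<theta>)"
    if x: "x \<in> carrier G"
      and \<theta>: "\<And>a b. a \<in> generate G {x} \<Longrightarrow> b \<in> generate G {x} \<Longrightarrow> \<theta> (a \<otimes> b) = \<theta> a * \<theta> b" for x \<theta>
  proof -
    let ?E = "conv_mat (extend0 (generate G {x}) \<theta>)"
    \<comment> \<open>The restriction is multiplicative here because the character matrix commutes
      with that of a class function; quasi-idempotence thus survives the restriction.\<close>
    have "\<phi> ?E * \<phi> ?E = \<phi> (?E * ?E)"
      using conv_mat_class_function_commute[OF hermitian2_symbol_class_function[OF S(2)]]
      by (intro mult[symmetric]) auto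
    also have "?E * ?E = of_int (int (card (generate G {x}))) \<cdot>\<^sub>m ?E"
      by (rule conv_mat_character_quasi_idempotent[OF generate_subgroup[OF x] \<theta>])
    finally show ?thesis unfolding Q_def smult[OF conv_mat_carrier]
      by (rule mat_tr_quasi_idempotent[OF \<phi>])
  qed
  ultimately have "Q (extend0 (carrier G) ?f)"
    using S(1) T D by (rule subtractive_hermitian2_symbol)
  moreover have "conv_mat (extend0 (carrier G) ?f) = conv_mat ?f"
    by (rule conv_mat_cong) (simp add: extend0_def)
  ultimately have "of_nat m * l \<in> \<int>" by (simp add: Q_def tr)
  then have "of_nat m * l / of_nat m \<in> \<rat>"
    using Ints_subset_Rats by (intro Rats_divide) auto
  then have "l \<in> \<rat>" using m by simp
  moreover have "algebraic_int l"
    by (rule algebraic_int_eigenvalue_hermitian2_values[OF conv_mat_carrier l])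
      (simp add: conv_mat_def hermitian2_symbol_values)
  ultimately show ?thesis by (rule rational_algebraic_int_is_int[rotated])
qed

end

end

theorem theorem4p4:
  fixes G :: "('a, 'b) monoid_scheme" and S :: "'a set"
  assumes "group G"
    and "finite (carrier G)"
    and "S \<subseteq> carrier G"
    and "\<one>\<^bsub>G\<^esub> \<notin> S"
    and "union_of_conjugacy_classes G S"
  shows "HS_integral (mixed_cayley_graph G S) \<longleftrightarrow>
    S - directed_part G S \<in> boolean_algebra_subgroups G \<and>
    directed_part G S \<in> skew_symmetric_unions3 G"
proof -
  have verts: "pverts (mixed_cayley_graph G S) = carrier G"
    by (simp add: mixed_cayley_graph_def)
  note matrix = group.hermitian2_matrix_mixed_cayley_graph[OF assms(1)]
  show ?thesis
  proof
    assume int: "HS_integral (mixed_cayley_graph G S)"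
    \<comment> \<open>One enumeration is enough in this direction; the converse treats an arbitrary
      one.\<close>
    obtain vs where vs: "distinct vs" "set vs = carrier G"
      using finite_distinct_list[OF assms(2)] by blast
    have ev: "e \<in> \<int>" if "eigenvalue (group.conv_mat G vs (group.hermitian2_symbol G S)) e" for e
      using int that vs unfolding HS_integral_def verts matrix[OF vs, symmetric] by blast
    show "S - directed_part G S \<in> boolean_algebra_subgroups G \<and>
        directed_part G S \<in> skew_symmetric_unions3 G"
      using group.integral_imp_boolean_algebra[OF assms(1) vs assms(3,5) ev]
        group.integral_imp_skew_symmetric_unions3[OF assms(1) vs assms(3,5) ev] by blast
  next
    assume unions: "S - directed_part G S \<in> boolean_algebra_subgroups G \<and>
      directed_part G S \<in> skew_symmetric_unions3 G"
    show "HS_integral (mixed_cayley_graph G S)"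
      unfolding HS_integral_def verts
    proof (intro allI impI)
      fix vs l assume "distinct vs \<and> set vs = carrier G"
        and l: "eigenvalue (hermitian2_matrix (mixed_cayley_graph G S) vs) l"
      then have vs: "distinct vs" "set vs = carrier G" by auto
      show "l \<in> \<int>"
        using group.integral_if_unions[OF assms(1) vs assms(3,5)] unions l
        unfolding matrix[OF vs] by blast
    qed
  qed
qed

end
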